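(* Let $0<q<1/2$, $p=1-q$, $\lambda=q/p$, let $z\geq 1$ and $A\geq z$ be integers, and write $[n]=\frac{1-\lambda^n}{1-\lambda}$ for $n\in\mathbb{N}$. For the $A$-Nakamoto double spend strategy (described in the context), with block reward $b>0$ and double-spent amount $v\geq 0$, the expected revenue $\mathbb{E}[\mathbf{R}_A]$ and the expected duration $\mathbb{E}[\mathbf{T}_A]$ of an attack cycle are \begin{align*} \frac{\mathbb{E}[\mathbf{R}_A]}{b} &= \frac{qz}{2p} I_{4pq}(z,1/2) - \frac{(A+1)\lambda^{A+1}}{p(1-\lambda)^3[A+1]^2} I_{(p-q)^2}(1/2,z) + \frac{2-\lambda+\lambda^{A+2}}{(1-\lambda)^2[A+1]}\,\frac{p^{z-1}q^z}{B(z,z)} + P_A(z)\left(\frac{v}{b}+1\right),\\ \frac{\mathbb{E}[\mathbf{T}_A]}{\tau_0} &= \frac{z}{2p} I_{4pq}(z,1/2) + \frac{A+1}{p(1-\lambda)^2[A+1]} I_{(p-q)^2}(1/2,z) - \frac{p^{z-1}q^z}{p(1-\lambda)B(z,z)} + \frac{1}{q}, \end{align*} where $P_A(z)$ is the probability of success of the attack, $I_x(a,b)=\frac{1}{B(a,b)}\int_0^x t^{a-1}(1-t)^{b-1}\,dt$ is the regularized incomplete Beta function and $B(a,b)=\int_0^1 t^{a-1}(1-t)^{b-1}\,dt$.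
   Context: Mining model: the attacker has relative hashrate $q$ and the honest miners relative hashrate $p=1-q$; blocks found by the honest miners and by the attacker form independent Poisson processes with rates $p/\tau_0$ and $q/\tau_0$ respectively ($\tau_0>0$ the mean interblock time); block propagation is instantaneous and difficulty is constant. The recipient of a transaction requires $z$ confirmations. The $A$-Nakamoto double spend strategy (with one pre-mined block) is: (1) the attacker mines on top of the last block of the official blockchain a block containing a transaction returning the payment funds to an address he controls; if the honest miners find a block first, he restarts mining on top of the new last official block; (2) once he has mined this one block (kept secret), he sends the paying transaction to the vendor and keeps mining on his secret fork, while the honest miners extend the official chain; (3) the lag is (number of official blocks after the fork point) minus (number of blocks of the secret fork); if the lag reaches $A$ the attacker gives up and the attack fails; (4) if, at a moment when the official chain has added at least $z$ blocks (confirmations of the vendor transaction), the secret fork is strictly longer than the official chain, the attacker publishes it and the attack succeeds. An attack cycle starts at step (1) and ends at success or failure; $\mathbf{T}_A$ is its duration (including the pre-mining time). The revenue $\mathbf{R}_A$ of a cycle is $v+b\cdot(\text{number of blocks of the published secret fork, including the pre-mined block})$ if the attack succeeds, and $0$ if it fails. *)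

theory Defs
  imports "HOL-Probability.Probability"
begin

definition inc_beta :: "real \<Rightarrow> real \<Rightarrow> real \<Rightarrow> real" where
  "inc_beta x a b = integral {0..x} (\<lambda>t. t powr (a - 1) * (1 - t) powr (b - 1)) / Beta a b"

definition qint :: "real \<Rightarrow> nat \<Rightarrow> real" where
  "qint l n = (1 - l ^ n) / (1 - l)"

text \<open>Sample point: omega i = (i-th honest interarrival time, i-th attacker interarrival time).
  Both sequences are i.i.d. exponential, rates p/tau0 and q/tau0, all independent:
  this is exactly a pair of independent Poisson processes.\<close>
definition mining_space :: "real \<Rightarrow> real \<Rightarrow> (nat \<Rightarrow> real \<times> real) measure" where
  "mining_space q tau0 = (\<Pi>\<^sub>M i\<in>UNIV.
      (density lborel (exponential_density ((1 - q) / tau0)) \<Otimes>\<^sub>M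
       density lborel (exponential_density (q / tau0))))"

definition hon_time :: "(nat \<Rightarrow> real \<times> real) \<Rightarrow> nat \<Rightarrow> real" where
  "hon_time \<omega> k = (\<Sum>i\<le>k. fst (\<omega> i))"
definition att_time :: "(nat \<Rightarrow> real \<times> real) \<Rightarrow> nat \<Rightarrow> real" where
  "att_time \<omega> k = (\<Sum>i\<le>k. snd (\<omega> i))"

definition Nh :: "(nat \<Rightarrow> real \<times> real) \<Rightarrow> real \<Rightarrow> nat" where
  "Nh \<omega> t = card {k. hon_time \<omega> k \<le> t}"
definition Na :: "(nat \<Rightarrow> real \<times> real) \<Rightarrow> real \<Rightarrow> nat" where
  "Na \<omega> t = card {k. att_time \<omega> k \<le> t}"

text \<open>End of pre-mining: first attacker block (honest blocks before it only move the
  fork point).\<close>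
definition premine_end :: "(nat \<Rightarrow> real \<times> real) \<Rightarrow> real" where
  "premine_end \<omega> = att_time \<omega> 0"

text \<open>Official blocks after the fork point, and blocks of the secret fork (incl. pre-mined).\<close>
definition off_len :: "(nat \<Rightarrow> real \<times> real) \<Rightarrow> real \<Rightarrow> int" where
  "off_len \<omega> t = int (Nh \<omega> t) - int (Nh \<omega> (premine_end \<omega>))"
definition sec_len :: "(nat \<Rightarrow> real \<times> real) \<Rightarrow> real \<Rightarrow> int" where
  "sec_len \<omega> t = 1 + int (Na \<omega> t) - int (Na \<omega> (premine_end \<omega>))"

definition attack_ended :: "nat \<Rightarrow> nat \<Rightarrow> (nat \<Rightarrow> real \<times> real) \<Rightarrow> real \<Rightarrow> bool" where
  "attack_ended A z \<omega> t \<longleftrightarrow> premine_end \<omega> \<le> t \<and>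
     (off_len \<omega> t - sec_len \<omega> t = int A \<or> (off_len \<omega> t \<ge> int z \<and> sec_len \<omega> t > off_len \<omega> t))"

definition end_time :: "nat \<Rightarrow> nat \<Rightarrow> (nat \<Rightarrow> real \<times> real) \<Rightarrow> real" where
  "end_time A z \<omega> = Inf {t. attack_ended A z \<omega> t}"

definition attack_success :: "nat \<Rightarrow> nat \<Rightarrow> (nat \<Rightarrow> real \<times> real) \<Rightarrow> bool" where
  "attack_success A z \<omega> \<longleftrightarrow> (\<exists>t. attack_ended A z \<omega> t) \<and>
     sec_len \<omega> (end_time A z \<omega>) > off_len \<omega> (end_time A z \<omega>)"

definition revenue :: "real \<Rightarrow> real \<Rightarrow> nat \<Rightarrow> nat \<Rightarrow> (nat \<Rightarrow> real \<times> real) \<Rightarrow> real" where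
  "revenue v b A z \<omega> = (if attack_success A z \<omega>
      then v + b * real_of_int (sec_len \<omega> (end_time A z \<omega>)) else 0)"

text \<open>Duration T_A of a cycle (0 on the null event that the cycle never ends).\<close>
definition duration :: "nat \<Rightarrow> nat \<Rightarrow> (nat \<Rightarrow> real \<times> real) \<Rightarrow> real" where
  "duration A z \<omega> = (if \<exists>t. attack_ended A z \<omega> t then end_time A z \<omega> else 0)"

end

theory Submission
  imports Defs
begin

text \<open>
  By the lack of memory of the exponential distribution, the pair of waiting-time sequences is
  reproduced after the first block: the waiting time is exponential with mean \<open>tau0\<close>, and
  independently of it the block is honest with probability \<open>p\<close> and the attacker's with
  probability \<open>q\<close>. Hence the expected reward of a race, as a function of the numbers \<open>h\<close> and \<open>s\<close> of
  official and secret blocks, solves a linear one-step equation on the strip \<open>h \<le> s + A\<close>. A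
  supersolution that contracts geometrically shows that this equation has only one solution of at
  most linear growth, so it suffices to exhibit one. Since \<open>z \<le> A\<close>, the cycle cannot end before
  the \<open>z\<close>-th official block; afterwards the lag is a gambler's ruin walk between \<open>-1\<close> and \<open>A\<close>.
  The solution is therefore a truncated negative binomial average of gambler's ruin values, and such
  truncated sums are incomplete Beta functions.
\<close>

section \<open>The incomplete Beta function\<close>

abbreviation beta_integrand :: "real \<Rightarrow> real \<Rightarrow> real \<Rightarrow> real" where
  "beta_integrand a b t \<equiv> t powr (a - 1) * (1 - t) powr (b - 1)"

lemma Beta_real_pos: "0 < a \<Longrightarrow> 0 < b \<Longrightarrow> 0 < Beta a (b :: real)"
  by (simp add: Beta_def Gamma_real_pos)

lemma beta_integrand_integrable:
  assumes "0 < a" "0 < b" "{c..d} \<subseteq> {0..1}"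
  shows "beta_integrand a b integrable_on {c..d}"
  using integrable_Beta'[OF assms(1,2)] assms(3) by (rule integrable_on_subinterval)

lemma inc_beta_reflect:
  assumes "0 < a" "0 < b" "0 \<le> x" "x \<le> 1"
  shows "inc_beta x a b + inc_beta (1 - x) b a = 1"
proof -
  have "integral {0..1 - x} (beta_integrand b a) = integral {x..1} (beta_integrand a b)"
  proof -
    have "(beta_integrand a b has_integral integral {x..1} (beta_integrand a b)) (cbox x 1)"
      using assms beta_integrand_integrable[of a b x 1] by (simp add: integrable_integral)
    from has_integral_affinity[OF this, of "-1" 1]
    have "(beta_integrand b a has_integral integral {x..1} (beta_integrand a b)) {0..1 - x}"
      using assms by (simp add: mult.commute)
    then show ?thesis by (rule integral_unique)
  qed
  moreover have "integral {0..x} (beta_integrand a b) + integral {x..1} (beta_integrand a b) = Beta a b"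
    using has_integral_Beta_real[OF assms(1,2)] assms integrable_Beta'[of a b]
    by (subst Henstock_Kurzweil_Integration.integral_combine) (auto simp: integral_unique)
  ultimately show ?thesis
    using Beta_real_pos[OF assms(1,2)] unfolding inc_beta_def Beta_commute[of b a]
    by (simp add: add_divide_distrib[symmetric])
qed

lemma image_logistic:
  fixes x :: real
  assumes "0 \<le> x" "x \<le> 1/2"
  shows "(\<lambda>u. 4 * u * (1 - u)) ` {0<..<x} = {0<..<4 * x * (1 - x)}"
proof (intro equalityI subsetI)
  have square: "4 * u * (1 - u) = 1 - (1 - 2 * u)\<^sup>2" for u :: real
    by (simp add: power2_eq_square algebra_simps)
  show "t \<in> {0<..<4 * x * (1 - x)}" if t: "t \<in> (\<lambda>u. 4 * u * (1 - u)) ` {0<..<x}" for t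
  proof -
    obtain u where u: "t = 4 * u * (1 - u)" "0 < u" "u < x"
      using t unfolding image_iff Bex_def greaterThanLessThan_iff by blast
    then have "(1 - 2 * x)\<^sup>2 < (1 - 2 * u)\<^sup>2" using assms by (intro power_strict_mono) auto
    moreover have "0 < 4 * u * (1 - u)" using u assms by simp
    ultimately show ?thesis unfolding u(1) by (simp add: square)
  qed
  show "t \<in> (\<lambda>u. 4 * u * (1 - u)) ` {0<..<x}" if "t \<in> {0<..<4 * x * (1 - x)}" for t
  proof
    have t: "0 < t" "(1 - 2 * x)\<^sup>2 < 1 - t" using that by (auto simp: square)
    moreover have "0 \<le> (1 - 2 * x)\<^sup>2" by simp
    ultimately have "t < 1" by linarith
    then show "t = 4 * ((1 - sqrt (1 - t)) / 2) * (1 - (1 - sqrt (1 - t)) / 2)"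
      unfolding square by (simp add: diff_divide_distrib)
    have "1 - 2 * x < sqrt (1 - t)" using t(2) by (rule real_less_rsqrt)
    then show "(1 - sqrt (1 - t)) / 2 \<in> {0<..<x}" using t(1) by simp
  qed
qed

lemma inj_on_logistic:
  fixes x :: real
  assumes "x \<le> 1/2"
  shows "inj_on (\<lambda>u. 4 * u * (1 - u)) {0<..<x}"
proof (rule inj_onI)
  fix u w assume "u \<in> {0<..<x}" "w \<in> {0<..<x}" "4 * u * (1 - u) = 4 * w * (1 - w)"
  then have "(u - w) * (1 - u - w) = 0" "u + w < 1"
    using assms by (auto simp: algebra_simps)
  then show "u = w" by simp
qed

lemma beta_integrand_logistic:
  assumes u: "0 < u" "u < 1/2"
  shows "\<bar>4 * (1 - 2 * u)\<bar> * beta_integrand a (1/2) (4 * u * (1 - u)) = 4 powr a * beta_integrand a a u"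
proof -
  have "1 - 4 * u * (1 - u) = (1 - 2 * u)\<^sup>2" by (simp add: power2_eq_square algebra_simps)
  then have "(1 - 4 * u * (1 - u)) powr (1/2 - 1) = ((1 - 2 * u) powr 2) powr (1/2 - 1)"
    using u by simp
  also have "\<dots> = 1 / (1 - 2 * u)"
    unfolding powr_powr using u by (simp add: powr_neg_one)
  finally have jacobian: "\<bar>4 * (1 - 2 * u)\<bar> * (1 - 4 * u * (1 - u)) powr (1/2 - 1) = 4"
    using u by (simp add: divide_eq_eq)
  have "\<bar>4 * (1 - 2 * u)\<bar> * beta_integrand a (1/2) (4 * u * (1 - u))
      = \<bar>4 * (1 - 2 * u)\<bar> * (1 - 4 * u * (1 - u)) powr (1/2 - 1) * (4 * u * (1 - u)) powr (a - 1)"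
    by (simp only: mult_ac)
  also have "\<dots> = 4 * (4 * u * (1 - u)) powr (a - 1)"
    unfolding jacobian ..
  also have "\<dots> = 4 powr a * beta_integrand a a u"
    using u by (simp add: powr_mult powr_diff)
  finally show ?thesis .
qed

lemma integral_beta_quadratic:
  assumes a: "0 < a" and x: "0 \<le> x" "x \<le> 1/2"
  shows "integral {0..4 * x * (1 - x)} (beta_integrand a (1/2))
    = 4 powr a * integral {0..x} (beta_integrand a a)"
proof -
  define g where "g = (\<lambda>u :: real. 4 * u * (1 - u))"
  have deriv: "(g has_field_derivative 4 * (1 - 2 * u)) (at u within {0<..<x})" for u
    unfolding g_def by (auto intro!: derivative_eq_intros simp: algebra_simps)
  have inj: "inj_on g {0<..<x}"
    using inj_on_logistic[OF x(2)] by (simp add: g_def)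
  have image: "g ` {0<..<x} = {0<..<4 * x * (1 - x)}"
    using image_logistic[OF x] by (simp add: g_def)
  have "4 * x * (1 - x) \<le> 1"
    using zero_le_power2[of "1 - 2 * x"] by (simp add: power2_eq_square algebra_simps)
  then have "g ` {0<..<x} \<subseteq> {0..1}" unfolding image by auto
  moreover have "beta_integrand a (1/2) absolutely_integrable_on {0..1}"
    using integrable_Beta'[of a "1/2"] a by (subst absolutely_integrable_on_iff_nonneg) auto
  ultimately have "beta_integrand a (1/2) absolutely_integrable_on g ` {0<..<x}"
    using image by (elim set_integrable_subset) auto
  with has_absolute_integral_change_of_variables_1'[OF _ deriv inj,
      of "beta_integrand a (1/2)" "integral (g ` {0<..<x}) (beta_integrand a (1/2))"]
  have "integral (g ` {0<..<x}) (beta_integrand a (1/2))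
      = integral {0<..<x} (\<lambda>u. \<bar>4 * (1 - 2 * u)\<bar> * beta_integrand a (1/2) (g u))"
    by simp
  also have "\<dots> = integral {0<..<x} (\<lambda>u. 4 powr a * beta_integrand a a u)"
    unfolding g_def using x(2) by (intro integral_cong beta_integrand_logistic) auto
  finally show ?thesis
    unfolding image by (simp add: integral_open_interval_real)
qed

lemma inc_beta_quadratic:
  assumes a: "0 < a" and x: "0 \<le> x" "x \<le> 1/2"
  shows "inc_beta (4 * x * (1 - x)) a (1/2) = 2 * inc_beta x a a"
proof -
  have "2 * integral {0..1/2} (beta_integrand a a) = Beta a a"
    using inc_beta_reflect[of a a "1/2"] a Beta_real_pos[of a a] by (simp add: inc_beta_def field_simps)
  moreover have "Beta a (1/2) = 4 powr a * integral {0..1/2} (beta_integrand a a)"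
    using integral_beta_quadratic[of a "1/2"] a has_integral_Beta_real[of a "1/2"]
    by (simp add: integral_unique)
  ultimately have "2 * Beta a (1/2) = 4 powr a * Beta a a" by simp
  then show ?thesis
    using Beta_real_pos[of a a] Beta_real_pos[of a "1/2"] a
    unfolding inc_beta_def integral_beta_quadratic[OF assms] by (simp add: field_simps)
qed

section \<open>Truncated negative binomial distributions\<close>

definition nbin_weight :: "nat \<Rightarrow> real \<Rightarrow> nat \<Rightarrow> real" where
  "nbin_weight n p k = real ((n + k - 1) choose k) * p ^ n * (1 - p) ^ k"

definition nbin_cdf :: "nat \<Rightarrow> nat \<Rightarrow> real \<Rightarrow> real" where
  "nbin_cdf n m p = (\<Sum>k<m. nbin_weight n p k)"

lemma Suc_times_nbin_weight_Suc:
  "real (Suc k) * nbin_weight n p (Suc k) = real (n + k) * (1 - p) * nbin_weight n p k"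
proof (cases n)
  case (Suc i)
  then have "real (Suc k) * real ((n + k) choose Suc k) = real (n + k) * real ((n + k - 1) choose k)"
    using Suc_times_binomial_eq[of "i + k" k]
    by (simp flip: of_nat_mult del: binomial_Suc_Suc of_nat_Suc mult_Suc add: mult.commute)
  then show ?thesis by (simp add: nbin_weight_def mult_ac)
qed (cases k; simp add: nbin_weight_def binomial_eq_0)

lemma nbin_truncated_mean:
  "p * (\<Sum>k<m. real k * nbin_weight n p k) = real n * (1 - p) * nbin_cdf n m p - real m * nbin_weight n p m"
proof (induction m)
  case (Suc m)
  have "p * (\<Sum>k<Suc m. real k * nbin_weight n p k) = real n * (1 - p) * nbin_cdf n m p
      - real m * nbin_weight n p m + p * (real m * nbin_weight n p m)"
    by (simp add: Suc distrib_left)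
  also have "\<dots> = real n * (1 - p) * nbin_cdf n (Suc m) p - real (n + m) * (1 - p) * nbin_weight n p m"
    by (simp add: nbin_cdf_def algebra_simps)
  finally show ?case unfolding Suc_times_nbin_weight_Suc .
qed (simp add: nbin_cdf_def)

lemma nbin_weight_Beta:
  assumes "1 \<le> n" "1 \<le> m"
  shows "real m * nbin_weight n p m = p ^ n * (1 - p) ^ m / Beta (real n) (real m)"
proof -
  obtain i j where ij: "n = Suc i" "m = Suc j" using assms by (metis Suc_le_D One_nat_def)
  have "Beta (real n) (real m) = fact i * fact j / fact (Suc (i + j))"
    using Gamma_fact[of i, where ?'a=real] Gamma_fact[of j, where ?'a=real]
      Gamma_fact[of "Suc (i + j)", where ?'a=real]
    by (simp add: Beta_def ij add_ac)
  moreover have "real (Suc (i + j) choose Suc j) = fact (Suc (i + j)) / (fact (Suc j) * fact i)"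
    by (subst binomial_fact) auto
  moreover have "(fact (Suc j) :: real) = real (Suc j) * fact j" by simp
  ultimately show ?thesis
    by (simp add: nbin_weight_def ij mult_ac del: fact_Suc of_nat_Suc power_Suc binomial_Suc_Suc)
qed

lemma nbin_weight_has_derivative:
  assumes "p \<noteq> 0" "p \<noteq> 1"
  shows "((\<lambda>p. nbin_weight n p k) has_real_derivative
    (real n / p - real k / (1 - p)) * nbin_weight n p k) (at p)"
proof -
  have "real n * p ^ (n - 1) = real n / p * p ^ n"
    "real k * (1 - p) ^ (k - 1) = real k / (1 - p) * (1 - p) ^ k"
    using assms by (cases n; cases k; simp)+
  then show ?thesis
    unfolding nbin_weight_def
    by (auto intro!: derivative_eq_intros simp: algebra_simps)
qed

lemma nbin_cdf_has_derivative:
  assumes "0 < p" "p < 1" "1 \<le> n" "1 \<le> m"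
  shows "((\<lambda>p. nbin_cdf n m p) has_real_derivative
    p ^ (n - 1) * (1 - p) ^ (m - 1) / Beta (real n) (real m)) (at p)"
proof -
  have "((\<lambda>p. nbin_cdf n m p) has_real_derivative
      (\<Sum>k<m. (real n / p - real k / (1 - p)) * nbin_weight n p k)) (at p)"
    unfolding nbin_cdf_def using assms by (intro DERIV_sum nbin_weight_has_derivative) auto
  also have "(\<Sum>k<m. (real n / p - real k / (1 - p)) * nbin_weight n p k)
      = real n / p * nbin_cdf n m p - (\<Sum>k<m. real k * nbin_weight n p k) / (1 - p)"
    by (simp add: nbin_cdf_def sum_distrib_left sum_divide_distrib
      sum_subtractf[symmetric] left_diff_distrib)
  also have "\<dots> = (real m * nbin_weight n p m) / (p * (1 - p))"
    using nbin_truncated_mean[of p n m] assms by (simp add: field_simps)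
  also have "\<dots> = p ^ (n - 1) * (1 - p) ^ (m - 1) / Beta (real n) (real m)"
    unfolding nbin_weight_Beta[OF assms(3,4)] using assms
    by (simp add: power_diff mult_ac)
  finally show ?thesis .
qed

lemma nbin_cdf_eq_inc_beta:
  assumes "0 \<le> x" "x \<le> 1" "1 \<le> n" "1 \<le> m"
  shows "nbin_cdf n m x = inc_beta x (real n) (real m)"
proof -
  let ?B = "Beta (real n) (real m)"
  have B: "?B > 0" using assms by (intro Beta_real_pos) auto
  have "(beta_integrand (real n) (real m) has_integral ?B * nbin_cdf n m x - ?B * nbin_cdf n m 0) {0..x}"
  proof (rule fundamental_theorem_of_calculus_interior)
    show "continuous_on {0..x} (\<lambda>t. ?B * nbin_cdf n m t)"
      unfolding nbin_cdf_def nbin_weight_def by (intro continuous_intros)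
    fix t assume "t \<in> {0<..<x}"
    then have t: "0 < t" "t < 1" using assms by auto
    then have "beta_integrand (real n) (real m) t = ?B * (t ^ (n - 1) * (1 - t) ^ (m - 1) / ?B)"
      using assms B by (simp add: powr_realpow[symmetric] of_nat_diff)
    then show "((\<lambda>t. ?B * nbin_cdf n m t) has_vector_derivative beta_integrand (real n) (real m) t) (at t)"
      using DERIV_cmult[OF nbin_cdf_has_derivative[OF t assms(3,4)], of ?B]
      by (simp add: has_real_derivative_iff_has_vector_derivative)
  qed (use assms in simp)
  moreover have "nbin_cdf n m 0 = 0" using assms by (simp add: nbin_cdf_def nbin_weight_def power_0_left)
  ultimately show ?thesis using B by (simp add: inc_beta_def integral_unique)
qed

lemma nbin_cdf_add_eq_1:
  assumes "0 \<le> p" "p \<le> 1" "1 \<le> n" "1 \<le> m"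
  shows "nbin_cdf n m p + nbin_cdf m n (1 - p) = 1"
  using inc_beta_reflect[of "real n" "real m" p] assms by (simp add: nbin_cdf_eq_inc_beta)

lemma nbin_weight_odds:
  assumes "p \<noteq> 0" "k \<le> n"
  shows "nbin_weight n p k * ((1 - p) / p) ^ (n - k) = nbin_weight n (1 - p) k"
proof -
  have "p ^ n * (1 - p) ^ k * ((1 - p) / p) ^ (n - k) = p ^ k * (1 - p) ^ n"
    using assms by (simp add: power_divide power_diff flip: power_add mult.assoc)
  then show ?thesis by (simp add: nbin_weight_def mult_ac)
qed

definition nbin_average :: "real \<Rightarrow> nat \<Rightarrow> (nat \<Rightarrow> real) \<Rightarrow> nat \<Rightarrow> nat \<Rightarrow> real" where
  "nbin_average p m \<phi> n s = (\<Sum>k\<le>m. nbin_weight n p k * \<phi> (s + k))"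

lemma nbin_weight_simps:
  "nbin_weight 0 p 0 = 1" "nbin_weight 0 p (Suc k) = 0" "nbin_weight (Suc n) p 0 = p * nbin_weight n p 0"
  "nbin_weight (Suc n) p (Suc k) = p * nbin_weight n p (Suc k) + (1 - p) * nbin_weight (Suc n) p k"
  by (simp_all add: nbin_weight_def algebra_simps)

lemma nbin_average_0: "nbin_average p m \<phi> 0 s = \<phi> s"
  unfolding nbin_average_def by (subst sum.atMost_shift) (simp add: nbin_weight_simps)

lemma nbin_average_Suc:
  assumes "\<And>t. m < t \<Longrightarrow> \<phi> t = 0"
  shows "nbin_average p m \<phi> (Suc n) s
    = p * nbin_average p m \<phi> n s + (1 - p) * nbin_average p m \<phi> (Suc n) (Suc s)"
proof -
  define q where "q = 1 - p"
  have "nbin_average p m \<phi> (Suc n) (Suc s) = (\<Sum>k<m. nbin_weight (Suc n) p k * \<phi> (s + Suc k))"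
    unfolding nbin_average_def lessThan_Suc_atMost[symmetric] using assms by simp
  then show ?thesis
    unfolding nbin_average_def sum.atMost_shift
    by (simp add: nbin_weight_simps sum.distrib sum_distrib_left algebra_simps flip: q_def)
qed

lemma nbin_average_eq_0: "(\<And>t. m < t \<Longrightarrow> \<phi> t = 0) \<Longrightarrow> m < s \<Longrightarrow> nbin_average p m \<phi> n s = 0"
  unfolding nbin_average_def by (intro sum.neutral) auto

section \<open>Two independent sequences of exponential waiting times\<close>

abbreviation exp_measure :: "real \<Rightarrow> real measure" where
  "exp_measure r \<equiv> density lborel (exponential_density r)"

abbreviation exp_seq :: "real \<Rightarrow> (nat \<Rightarrow> real) measure" where
  "exp_seq r \<equiv> \<Pi>\<^sub>M i\<in>UNIV. exp_measure r"

abbreviation exp_seq2 :: "real \<Rightarrow> real \<Rightarrow> ((nat \<Rightarrow> real) \<times> (nat \<Rightarrow> real)) measure" where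
  "exp_seq2 a b \<equiv> exp_seq a \<Otimes>\<^sub>M exp_seq b"

lemma AE_exp_measure_pos: "0 < r \<Longrightarrow> AE u in exp_measure r. 0 < u"
  using AE_lborel_singleton[of "0::real"]
  by (subst AE_density) (auto simp: exponential_density_def elim!: eventually_mono)

lemma nn_integral_exp_measure_linear:
  assumes "0 < r" "0 \<le> c"
  shows "(\<integral>\<^sup>+u. ennreal (c * u) \<partial>exp_measure r) = ennreal (c / r)"
proof -
  have "(\<integral>\<^sup>+u. ennreal (c * u) \<partial>exp_measure r)
      = (\<integral>\<^sup>+u. ennreal c * ennreal (exponential_density r u * u ^ 1) \<partial>lborel)"
    using assms by (subst nn_integral_density)
      (auto intro!: nn_integral_cong simp: exponential_density_def
        ennreal_mult[symmetric] mult_ac split: if_split)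
  also have "\<dots> = ennreal c * ennreal (fact (0 + 1) / (fact 0 * r ^ 1))"
    using nn_integral_erlang_ith_moment[OF assms(1), of 0 1] by (subst nn_integral_cmult) auto
  finally show ?thesis using assms by (simp add: ennreal_mult[symmetric])
qed

lemma nn_integral_exp_measure_exp:
  assumes "0 < r" "0 \<le> t"
  shows "(\<integral>\<^sup>+u. ennreal (exp (- t * u)) \<partial>exp_measure r) = ennreal (r / (r + t))"
proof -
  have "(\<integral>\<^sup>+u. ennreal (exp (- t * u)) \<partial>exp_measure r)
      = (\<integral>\<^sup>+u. ennreal (r / (r + t)) * ennreal (exponential_density (r + t) u) \<partial>lborel)"
    using assms by (subst nn_integral_density)
      (auto intro!: nn_integral_cong simp: exponential_density_def
        ennreal_mult[symmetric] exp_add[symmetric] field_simps)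
  also have "\<dots> = ennreal (r / (r + t)) * emeasure (exp_measure (r + t)) UNIV"
    by (simp add: nn_integral_cmult emeasure_density)
  finally show ?thesis
    using prob_space.emeasure_space_1[OF prob_space_exponential_density[of "r + t"]] assms by simp
qed

lemma nn_integral_exp_measure_tail:
  assumes "0 \<le> x" and [measurable]: "f \<in> borel_measurable borel"
  shows "(\<integral>\<^sup>+y. (if x < y then f y else 0) \<partial>exp_measure r)
    = ennreal (exp (- (x * r))) * (\<integral>\<^sup>+w. f (x + w) \<partial>exp_measure r)"
proof -
  have density: "exponential_density r (x + w) = exp (- (x * r)) * exponential_density r w" if "0 < w" for w
    using that assms(1) by (simp add: exponential_density_def exp_add[symmetric] algebra_simps)
  have "(\<integral>\<^sup>+y. (if x < y then f y else 0) \<partial>exp_measure r)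
      = (\<integral>\<^sup>+w. ennreal (exponential_density r (x + w)) * (if 0 < w then f (x + w) else 0) \<partial>lborel)"
    by (simp add: nn_integral_density) (subst nn_integral_real_affine[where c=1 and t=x], auto cong: if_cong)
  also have "\<dots> = (\<integral>\<^sup>+w. ennreal (exp (- (x * r))) * (ennreal (exponential_density r w) * f (x + w)) \<partial>lborel)"
    using AE_lborel_singleton[of "0::real"]
  proof (intro nn_integral_cong_AE, eventually_elim)
    case (elim w)
    show ?case
    proof (cases "0 < w")
      case True
      then show ?thesis by (simp add: density ennreal_mult' mult.assoc)
    next
      case False
      with elim show ?thesis by (simp add: exponential_density_def)
    qed
  qed
  also have "\<dots> = ennreal (exp (- (x * r))) * (\<integral>\<^sup>+w. f (x + w) \<partial>exp_measure r)"
    by (simp add: nn_integral_cmult nn_integral_density)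
  finally show ?thesis .
qed

lemma nn_integral_exp_measure_less:
  fixes g :: "real \<Rightarrow> real \<Rightarrow> ennreal"
  assumes a: "0 < a" and b: "0 < b"
    and [measurable]: "(\<lambda>(x, y). g x y) \<in> borel_measurable (borel \<Otimes>\<^sub>M borel)"
  shows "(\<integral>\<^sup>+x. \<integral>\<^sup>+y. (if x < y then g x y else 0) \<partial>exp_measure b \<partial>exp_measure a)
    = ennreal (a / (a + b)) * (\<integral>\<^sup>+u. \<integral>\<^sup>+w. g u (u + w) \<partial>exp_measure b \<partial>exp_measure (a + b))"
proof -
  interpret B: prob_space "exp_measure b" by (rule prob_space_exponential_density[OF b])
  have density: "ennreal (exponential_density a x) * ennreal (exp (- (x * b)))
      = ennreal (a / (a + b)) * ennreal (exponential_density (a + b) x)" for x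
    using a b by (simp add: exponential_density_def ennreal_mult[symmetric] exp_add[symmetric] field_simps)
  have "(\<integral>\<^sup>+x. \<integral>\<^sup>+y. (if x < y then g x y else 0) \<partial>exp_measure b \<partial>exp_measure a)
      = (\<integral>\<^sup>+x. ennreal (exp (- (x * b))) * (\<integral>\<^sup>+w. g x (x + w) \<partial>exp_measure b) \<partial>exp_measure a)"
    using AE_exp_measure_pos[OF a]
    by (intro nn_integral_cong_AE, eventually_elim) (simp add: nn_integral_exp_measure_tail)
  also have "\<dots> = (\<integral>\<^sup>+x. ennreal (a / (a + b)) * (ennreal (exponential_density (a + b) x)
      * (\<integral>\<^sup>+w. g x (x + w) \<partial>exp_measure b)) \<partial>lborel)"
    by (subst nn_integral_density) (simp_all add: density mult.assoc[symmetric])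
  also have "\<dots> = ennreal (a / (a + b)) * (\<integral>\<^sup>+u. \<integral>\<^sup>+w. g u (u + w) \<partial>exp_measure b \<partial>exp_measure (a + b))"
    by (subst nn_integral_cmult)
       (simp_all add: nn_integral_density[of "\<lambda>x. ennreal (exponential_density (a + b) x)"])
  finally show ?thesis .
qed

lemma nn_integral_competing_exponentials:
  fixes g :: "real \<Rightarrow> real \<Rightarrow> ennreal"
  assumes a: "0 < a" and b: "0 < b"
    and [measurable]: "(\<lambda>(x, y). g x y) \<in> borel_measurable (borel \<Otimes>\<^sub>M borel)"
  shows "(\<integral>\<^sup>+x. \<integral>\<^sup>+y. g x y \<partial>exp_measure b \<partial>exp_measure a) =
      ennreal (a / (a + b)) * (\<integral>\<^sup>+u. \<integral>\<^sup>+w. g u (u + w) \<partial>exp_measure b \<partial>exp_measure (a + b))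
    + ennreal (b / (a + b)) * (\<integral>\<^sup>+u. \<integral>\<^sup>+w. g (u + w) u \<partial>exp_measure a \<partial>exp_measure (a + b))"
proof -
  interpret A: prob_space "exp_measure a" by (rule prob_space_exponential_density[OF a])
  interpret B: prob_space "exp_measure b" by (rule prob_space_exponential_density[OF b])
  interpret pair_sigma_finite "exp_measure a" "exp_measure b" ..
  have "(\<integral>\<^sup>+x. \<integral>\<^sup>+y. g x y \<partial>exp_measure b \<partial>exp_measure a)
      = (\<integral>\<^sup>+x. \<integral>\<^sup>+y. (if x < y then g x y else 0) + (if y < x then g x y else 0)
          \<partial>exp_measure b \<partial>exp_measure a)"
  proof (rule nn_integral_cong, rule nn_integral_cong_AE)
    fix x :: real
    have "AE y in exp_measure b. y \<noteq> x"
      using AE_lborel_singleton[of x] by (subst AE_density) (auto elim!: eventually_mono)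
    then show "AE y in exp_measure b. g x y = (if x < y then g x y else 0) + (if y < x then g x y else 0)"
      by eventually_elim auto
  qed
  also have "\<dots> = (\<integral>\<^sup>+x. \<integral>\<^sup>+y. (if x < y then g x y else 0) \<partial>exp_measure b \<partial>exp_measure a)
      + (\<integral>\<^sup>+x. \<integral>\<^sup>+y. (if y < x then g x y else 0) \<partial>exp_measure b \<partial>exp_measure a)"
    by (simp add: nn_integral_add)
  also have "(\<integral>\<^sup>+x. \<integral>\<^sup>+y. (if y < x then g x y else 0) \<partial>exp_measure b \<partial>exp_measure a)
      = (\<integral>\<^sup>+y. \<integral>\<^sup>+x. (if y < x then g x y else 0) \<partial>exp_measure a \<partial>exp_measure b)"
    by (rule Fubini'[symmetric]) measurable
  also have "\<dots> = ennreal (b / (a + b)) * (\<integral>\<^sup>+u. \<integral>\<^sup>+w. g (u + w) u \<partial>exp_measure a \<partial>exp_measure (a + b))"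
    unfolding add.commute[of a b] by (rule nn_integral_exp_measure_less[OF b a]) measurable
  also note nn_integral_exp_measure_less[OF a b assms(3)]
  finally show ?thesis .
qed

lemma (in sequence_space) nn_integral_PiM_case_nat:
  assumes [measurable]: "f \<in> borel_measurable S"
  shows "(\<integral>\<^sup>+x. f x \<partial>S) = (\<integral>\<^sup>+h. \<integral>\<^sup>+x. f (case_nat h x) \<partial>S \<partial>M)"
proof -
  have "(\<integral>\<^sup>+x. f x \<partial>S) = (\<integral>\<^sup>+x. f x \<partial>distr (M \<Otimes>\<^sub>M S) S (\<lambda>(s, \<omega>). case_nat s \<omega>))"
    by (simp only: PiM_iter)
  also have "\<dots> = (\<integral>\<^sup>+(s, \<omega>). f (case_nat s \<omega>) \<partial>(M \<Otimes>\<^sub>M S))"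
    by (subst nn_integral_distr) (auto simp: case_prod_beta')
  also have "\<dots> = (\<integral>\<^sup>+h. \<integral>\<^sup>+x. f (case_nat h x) \<partial>S \<partial>M)"
    by (subst P.nn_integral_fst[symmetric]) auto
  finally show ?thesis .
qed

lemma sequence_space_exp_measure: "0 < r \<Longrightarrow> sequence_space (exp_measure r)"
  unfolding sequence_space_def product_prob_space_def
    product_sigma_finite_def product_prob_space_axioms_def
  by (simp add: prob_space_exponential_density prob_space_imp_sigma_finite)

definition delay :: "real \<Rightarrow> (nat \<Rightarrow> real) \<Rightarrow> nat \<Rightarrow> real" where
  "delay u x = x(0 := u + x 0)"

lemma delay_case_nat: "delay u (case_nat w x) = case_nat (u + w) x"
  by (auto simp: delay_def fun_eq_iff split: nat.split)

lemma measurable_delay[measurable]: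
  "(\<lambda>(u, x). delay u x) \<in> borel \<Otimes>\<^sub>M exp_seq r \<rightarrow>\<^sub>M exp_seq r"
proof (rule measurable_PiM_single')
  show "(\<lambda>\<omega>. (case \<omega> of (u, x) \<Rightarrow> delay u x) i) \<in> borel \<Otimes>\<^sub>M exp_seq r \<rightarrow>\<^sub>M exp_measure r" for i
    by (cases i) (auto simp: delay_def case_prod_beta')
qed (auto simp: space_PiM)

lemma measurable_case_nat_exp_seq[measurable]:
  "(\<lambda>(u, x). case_nat u x) \<in> borel \<Otimes>\<^sub>M exp_seq r \<rightarrow>\<^sub>M exp_seq r"
proof (rule measurable_PiM_single')
  show "(\<lambda>\<omega>. (case \<omega> of (u, x) \<Rightarrow> case_nat u x) i) \<in> borel \<Otimes>\<^sub>M exp_seq r \<rightarrow>\<^sub>M exp_measure r" for i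
    by (cases i) (auto simp: case_prod_beta')
qed (auto simp: space_PiM)

locale two_clocks =
  fixes a b :: real
  assumes a_pos: "0 < a" and b_pos: "0 < b"
begin

sublocale A: sequence_space "exp_measure a" by (rule sequence_space_exp_measure[OF a_pos])
sublocale B: sequence_space "exp_measure b" by (rule sequence_space_exp_measure[OF b_pos])
sublocale pair_prob_space "exp_seq a" "exp_seq b" ..

lemma nn_integral_exp_seq2_case_nat_fst:
  assumes [measurable]: "F \<in> borel_measurable (exp_seq2 a b)"
  shows "(\<integral>\<^sup>+\<omega>. F \<omega> \<partial>exp_seq2 a b)
    = (\<integral>\<^sup>+h. \<integral>\<^sup>+\<omega>. F (case_nat h (fst \<omega>), snd \<omega>) \<partial>exp_seq2 a b \<partial>exp_measure a)"
proof -
  have "(\<integral>\<^sup>+\<omega>. F \<omega> \<partial>exp_seq2 a b) = (\<integral>\<^sup>+x. \<integral>\<^sup>+y. F (x, y) \<partial>exp_seq b \<partial>exp_seq a)"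
    by (rule B.P.nn_integral_fst[symmetric]) measurable
  also have "\<dots> = (\<integral>\<^sup>+h. \<integral>\<^sup>+x. \<integral>\<^sup>+y. F (case_nat h x, y) \<partial>exp_seq b \<partial>exp_seq a \<partial>exp_measure a)"
    by (rule A.nn_integral_PiM_case_nat) measurable
  also have "\<dots> = (\<integral>\<^sup>+h. \<integral>\<^sup>+\<omega>. F (case_nat h (fst \<omega>), snd \<omega>) \<partial>exp_seq2 a b \<partial>exp_measure a)"
    by (subst B.P.nn_integral_fst[symmetric]) simp_all
  finally show ?thesis .
qed

lemma nn_integral_exp_seq2_case_nat_snd:
  assumes [measurable]: "F \<in> borel_measurable (exp_seq2 a b)"
  shows "(\<integral>\<^sup>+\<omega>. F \<omega> \<partial>exp_seq2 a b)
    = (\<integral>\<^sup>+k. \<integral>\<^sup>+\<omega>. F (fst \<omega>, case_nat k (snd \<omega>)) \<partial>exp_seq2 a b \<partial>exp_measure b)"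
proof -
  have "(\<integral>\<^sup>+\<omega>. F \<omega> \<partial>exp_seq2 a b) = (\<integral>\<^sup>+y. \<integral>\<^sup>+x. F (x, y) \<partial>exp_seq a \<partial>exp_seq b)"
    by (rule nn_integral_snd[symmetric]) measurable
  also have "\<dots> = (\<integral>\<^sup>+k. \<integral>\<^sup>+y. \<integral>\<^sup>+x. F (x, case_nat k y) \<partial>exp_seq a \<partial>exp_seq b \<partial>exp_measure b)"
    by (rule B.nn_integral_PiM_case_nat) measurable
  also have "\<dots> = (\<integral>\<^sup>+k. \<integral>\<^sup>+\<omega>. F (fst \<omega>, case_nat k (snd \<omega>)) \<partial>exp_seq2 a b \<partial>exp_measure b)"
    by (subst nn_integral_snd[symmetric]) (simp_all add: case_prod_beta')
  finally show ?thesis .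
qed

lemma nn_integral_first_block:
  assumes [measurable]: "F \<in> borel_measurable (exp_seq2 a b)"
  shows "(\<integral>\<^sup>+\<omega>. F \<omega> \<partial>exp_seq2 a b) =
      ennreal (a / (a + b)) * (\<integral>\<^sup>+u. \<integral>\<^sup>+\<omega>. F (case_nat u (fst \<omega>), delay u (snd \<omega>))
        \<partial>exp_seq2 a b \<partial>exp_measure (a + b))
    + ennreal (b / (a + b)) * (\<integral>\<^sup>+u. \<integral>\<^sup>+\<omega>. F (delay u (fst \<omega>), case_nat u (snd \<omega>))
        \<partial>exp_seq2 a b \<partial>exp_measure (a + b))"
proof -
  define g where "g h k = (\<integral>\<^sup>+\<omega>. F (case_nat h (fst \<omega>), case_nat k (snd \<omega>)) \<partial>exp_seq2 a b)" for h k
  have [measurable]: "(\<lambda>(h, k). g h k) \<in> borel_measurable (borel \<Otimes>\<^sub>M borel)"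
    unfolding g_def by measurable
  have "(\<integral>\<^sup>+\<omega>. F \<omega> \<partial>exp_seq2 a b)
      = (\<integral>\<^sup>+h. \<integral>\<^sup>+\<omega>. F (case_nat h (fst \<omega>), snd \<omega>) \<partial>exp_seq2 a b \<partial>exp_measure a)"
    by (rule nn_integral_exp_seq2_case_nat_fst) measurable
  also have "\<dots> = (\<integral>\<^sup>+h. \<integral>\<^sup>+k. g h k \<partial>exp_measure b \<partial>exp_measure a)"
    unfolding g_def by (intro nn_integral_cong, subst nn_integral_exp_seq2_case_nat_snd) simp_all
  also have "\<dots> = ennreal (a / (a + b)) * (\<integral>\<^sup>+u. \<integral>\<^sup>+w. g u (u + w) \<partial>exp_measure b \<partial>exp_measure (a + b))
      + ennreal (b / (a + b)) * (\<integral>\<^sup>+u. \<integral>\<^sup>+w. g (u + w) u \<partial>exp_measure a \<partial>exp_measure (a + b))"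
    by (rule nn_integral_competing_exponentials[OF a_pos b_pos]) measurable
  finally have "(\<integral>\<^sup>+\<omega>. F \<omega> \<partial>exp_seq2 a b) = \<dots>" .
  moreover have "(\<integral>\<^sup>+w. g u (u + w) \<partial>exp_measure b)
      = (\<integral>\<^sup>+\<omega>. F (case_nat u (fst \<omega>), delay u (snd \<omega>)) \<partial>exp_seq2 a b)" for u
    unfolding g_def by (subst nn_integral_exp_seq2_case_nat_snd) (simp_all add: delay_case_nat)
  moreover have "(\<integral>\<^sup>+w. g (u + w) u \<partial>exp_measure a)
      = (\<integral>\<^sup>+\<omega>. F (delay u (fst \<omega>), case_nat u (snd \<omega>)) \<partial>exp_seq2 a b)" for u
    unfolding g_def by (subst nn_integral_exp_seq2_case_nat_fst) (simp_all add: delay_case_nat)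
  ultimately show ?thesis by simp
qed

end

lemma (in product_prob_space) nn_integral_PiM_prod:
  assumes "finite J" "J \<subseteq> I" and f: "\<And>i. i \<in> J \<Longrightarrow> f i \<in> borel_measurable (M i)"
  shows "(\<integral>\<^sup>+x. (\<Prod>i\<in>J. f i (x i)) \<partial>PiM I M) = (\<Prod>i\<in>J. \<integral>\<^sup>+x. f i x \<partial>M i)"
proof -
  have "(\<integral>\<^sup>+x. (\<Prod>i\<in>J. f i (x i)) \<partial>PiM I M) = (\<integral>\<^sup>+x. (\<Prod>i\<in>J. f i (restrict x J i)) \<partial>PiM I M)"
    by (intro nn_integral_cong prod.cong) auto
  also have "\<dots> = (\<integral>\<^sup>+x. (\<Prod>i\<in>J. f i (x i)) \<partial>distr (PiM I M) (PiM J M) (\<lambda>x. restrict x J))"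
    using f assms(2) by (subst nn_integral_distr)
      (auto intro!: borel_measurable_prod_ennreal
        measurable_compose[OF measurable_component_singleton] measurable_restrict_subset)
  also have "\<dots> = (\<Prod>i\<in>J. \<integral>\<^sup>+x. f i x \<partial>M i)"
    using assms by (simp add: distr_PiM_restrict_finite product_nn_integral_prod)
  finally show ?thesis .
qed

definition zip_seq :: "(nat \<Rightarrow> 'a) \<times> (nat \<Rightarrow> 'b) \<Rightarrow> nat \<Rightarrow> 'a \<times> 'b" where
  "zip_seq xy i = (fst xy i, snd xy i)"

lemma measurable_zip_seq[measurable]:
  "zip_seq \<in> (\<Pi>\<^sub>M i\<in>UNIV. M) \<Otimes>\<^sub>M (\<Pi>\<^sub>M i\<in>UNIV. N) \<rightarrow>\<^sub>M (\<Pi>\<^sub>M i\<in>UNIV. M \<Otimes>\<^sub>M N)"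
proof (rule measurable_PiM_single')
  show "(\<lambda>xy. zip_seq xy i) \<in> (\<Pi>\<^sub>M i\<in>UNIV. M) \<Otimes>\<^sub>M (\<Pi>\<^sub>M i\<in>UNIV. N) \<rightarrow>\<^sub>M M \<Otimes>\<^sub>M N" for i
    unfolding zip_seq_def by measurable
qed (auto simp: space_pair_measure space_PiM zip_seq_def)

lemma nn_integral_zip_seq_prod:
  assumes M: "prob_space M" and N: "prob_space N"
    and J: "finite J" and X[measurable]: "\<And>i. i \<in> J \<Longrightarrow> X i \<in> sets (M \<Otimes>\<^sub>M N)"
  shows "(\<integral>\<^sup>+\<omega>. (\<Prod>i\<in>J. indicator (X i) (zip_seq \<omega> i)) \<partial>((\<Pi>\<^sub>M i\<in>UNIV. M) \<Otimes>\<^sub>M (\<Pi>\<^sub>M i\<in>UNIV. N)))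
    = (\<Prod>i\<in>J. emeasure (M \<Otimes>\<^sub>M N) (X i))"
proof -
  interpret M: product_prob_space "\<lambda>_. M" "UNIV :: nat set"
    by (intro product_prob_spaceI M)
  interpret N: product_prob_space "\<lambda>_. N" "UNIV :: nat set"
    by (intro product_prob_spaceI N)
  interpret MN: pair_prob_space M N
    using M N by (simp add: pair_prob_space_def pair_sigma_finite_def prob_space_imp_sigma_finite)
  interpret pair_prob_space "\<Pi>\<^sub>M i\<in>(UNIV :: nat set). M" "\<Pi>\<^sub>M i\<in>(UNIV :: nat set). N" ..
  have "(\<integral>\<^sup>+\<omega>. (\<Prod>i\<in>J. indicator (X i) (zip_seq \<omega> i)) \<partial>((\<Pi>\<^sub>M i\<in>UNIV. M) \<Otimes>\<^sub>M (\<Pi>\<^sub>M i\<in>UNIV. N)))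
      = (\<integral>\<^sup>+y. \<integral>\<^sup>+x. (\<Prod>i\<in>J. indicator (X i) (x i, y i)) \<partial>(\<Pi>\<^sub>M i\<in>UNIV. M) \<partial>(\<Pi>\<^sub>M i\<in>UNIV. N))"
    unfolding zip_seq_def by (subst nn_integral_snd[symmetric])
      (auto intro!: borel_measurable_prod_ennreal simp: case_prod_beta')
  also have "\<dots> = (\<integral>\<^sup>+y. (\<Prod>i\<in>J. \<integral>\<^sup>+x. indicator (X i) (x, y i) \<partial>M) \<partial>(\<Pi>\<^sub>M i\<in>UNIV. N))"
    by (intro nn_integral_cong M.nn_integral_PiM_prod[OF J]) (auto simp: space_PiM PiE_iff)
  also have "\<dots> = (\<Prod>i\<in>J. \<integral>\<^sup>+y. \<integral>\<^sup>+x. indicator (X i) (x, y) \<partial>M \<partial>N)"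
    by (rule N.nn_integral_PiM_prod[OF J]) simp_all
  also have "\<dots> = (\<Prod>i\<in>J. emeasure (M \<Otimes>\<^sub>M N) (X i))"
    by (intro prod.cong refl) (subst MN.nn_integral_snd, auto)
  finally show ?thesis .
qed

lemma distr_zip_seq:
  assumes M: "prob_space M" and N: "prob_space N"
  shows "distr ((\<Pi>\<^sub>M i\<in>UNIV. M) \<Otimes>\<^sub>M (\<Pi>\<^sub>M i\<in>UNIV. N)) (\<Pi>\<^sub>M i\<in>UNIV. M \<Otimes>\<^sub>M N) zip_seq
    = (\<Pi>\<^sub>M i\<in>UNIV. M \<Otimes>\<^sub>M N)"
proof -
  let ?P = "(\<Pi>\<^sub>M i\<in>(UNIV :: nat set). M) \<Otimes>\<^sub>M (\<Pi>\<^sub>M i\<in>(UNIV :: nat set). N)"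
  interpret product_prob_space "\<lambda>_. M \<Otimes>\<^sub>M N" "UNIV :: nat set"
    by (intro product_prob_spaceI prob_space_pair M N)
  show ?thesis
  proof (rule PiM_eq)
    fix J :: "nat set" and X :: "nat \<Rightarrow> ('a \<times> 'b) set"
    assume J: "finite J" and X: "\<And>i. i \<in> J \<Longrightarrow> X i \<in> sets (M \<Otimes>\<^sub>M N)"
    let ?E = "prod_emb UNIV (\<lambda>_. M \<Otimes>\<^sub>M N) J (Pi\<^sub>E J X)"
    have E[measurable]: "?E \<in> sets (\<Pi>\<^sub>M i\<in>UNIV. M \<Otimes>\<^sub>M N)"
      using J X by (intro sets_PiM_I) auto
    have "emeasure (distr ?P (\<Pi>\<^sub>M i\<in>UNIV. M \<Otimes>\<^sub>M N) zip_seq) ?E = (\<integral>\<^sup>+\<omega>. indicator ?E (zip_seq \<omega>) \<partial>?P)"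
      by (subst nn_integral_distr[OF measurable_zip_seq, symmetric]) simp_all
    also have "\<dots> = (\<integral>\<^sup>+\<omega>. (\<Prod>i\<in>J. indicator (X i) (zip_seq \<omega> i)) \<partial>?P)"
    proof (rule nn_integral_cong)
      fix \<omega> assume "\<omega> \<in> space ?P"
      then have "zip_seq \<omega> \<in> space (\<Pi>\<^sub>M i\<in>UNIV. M \<Otimes>\<^sub>M N)"
        by (rule measurable_space[OF measurable_zip_seq])
      then have "zip_seq \<omega> \<in> ?E \<longleftrightarrow> (\<forall>i\<in>J. zip_seq \<omega> i \<in> X i)"
        by (auto simp: prod_emb_def space_PiM PiE_iff)
      then show "indicator ?E (zip_seq \<omega>) = (\<Prod>i\<in>J. indicator (X i) (zip_seq \<omega> i) :: ennreal)"
        using J by (auto simp: indicator_def prod_zero_iff)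
    qed
    also have "\<dots> = (\<Prod>i\<in>J. emeasure (M \<Otimes>\<^sub>M N) (X i))"
      by (rule nn_integral_zip_seq_prod[OF M N J X])
    finally show "emeasure (distr ?P (\<Pi>\<^sub>M i\<in>UNIV. M \<Otimes>\<^sub>M N) zip_seq) ?E = \<dots>" .
  qed simp
qed

section \<open>Counting arrivals\<close>

definition arrival :: "(nat \<Rightarrow> real) \<Rightarrow> nat \<Rightarrow> real" where
  "arrival x k = (\<Sum>i\<le>k. x i)"

definition counting :: "(nat \<Rightarrow> real) \<Rightarrow> real \<Rightarrow> nat" where
  "counting X t = card {k. X k \<le> t}"

definition proper_waits :: "(nat \<Rightarrow> real) \<Rightarrow> bool" where
  "proper_waits x \<longleftrightarrow> (\<forall>i. 0 < x i) \<and> (\<forall>t. finite {k. arrival x k \<le> t})"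

lemma arrival_case_nat_Suc: "arrival (case_nat u x) (Suc k) = u + arrival x k"
  unfolding arrival_def sum.atMost_Suc_shift by simp

lemma arrival_delay: "arrival (delay u x) k = u + arrival x k"
  unfolding arrival_def by (induction k) (simp_all add: delay_def)

lemma arrival_pos: "proper_waits x \<Longrightarrow> 0 < arrival x k"
  unfolding arrival_def proper_waits_def by (intro sum_pos) auto

lemma arrival_le_first:
  assumes "proper_waits x"
  shows "arrival x k \<le> x 0 \<longleftrightarrow> k = 0"
proof (cases k)
  case (Suc n)
  have "0 < (\<Sum>i\<le>n. x (Suc i))" using assms unfolding proper_waits_def by (intro sum_pos) auto
  then show ?thesis unfolding Suc arrival_def sum.atMost_Suc_shift by simp
qed (simp add: arrival_def)

lemma counting_eq_0: "(\<And>k. t < X k) \<Longrightarrow> counting X t = 0"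
  unfolding counting_def by (metis (mono_tags, lifting) Collect_empty_eq card.empty not_less)

lemma counting_mono: "proper_waits x \<Longrightarrow> s \<le> t \<Longrightarrow> counting (arrival x) s \<le> counting (arrival x) t"
  unfolding counting_def proper_waits_def by (intro card_mono) auto

lemma counting_first: "proper_waits x \<Longrightarrow> counting (arrival x) (x 0) = 1"
  by (simp add: counting_def arrival_le_first)

lemma counting_before_first:
  assumes "proper_waits x" "t < x 0"
  shows "counting (arrival x) t = 0"
proof (rule counting_eq_0)
  show "t < arrival x k" for k
    using assms arrival_le_first[OF assms(1), of k] by (cases k) (auto simp: arrival_def)
qed

lemma counting_delay: "counting (arrival (delay u x)) (u + t) = counting (arrival x) t"
  by (simp add: counting_def arrival_delay)

lemma counting_case_nat:
  assumes "proper_waits x" "0 \<le> t"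
  shows "counting (arrival (case_nat u x)) (u + t) = Suc (counting (arrival x) t)"
proof -
  have "{k. arrival (case_nat u x) k \<le> u + t} = insert 0 (Suc ` {k. arrival x k \<le> t})" (is "?L = ?R")
  proof (rule set_eqI)
    show "k \<in> ?L \<longleftrightarrow> k \<in> ?R" for k
    proof (cases k)
      case 0
      then show ?thesis using assms(2) by (simp add: arrival_def)
    qed (auto simp: arrival_case_nat_Suc)
  qed
  then show ?thesis
    using assms(1) by (simp add: counting_def proper_waits_def card_image)
qed

lemma AE_exp_seq_finite_arrivals:
  assumes r: "0 < r"
  shows "AE x in exp_seq r. \<forall>t. finite {k. arrival x k \<le> t}"
proof -
  interpret product_prob_space "\<lambda>_. exp_measure r" "UNIV :: nat set"
    by (intro product_prob_spaceI prob_space_exponential_density r)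
  define \<rho> where "\<rho> = r / (r + 1)"
  have \<rho>: "0 \<le> \<rho>" "\<rho> < 1" using r by (auto simp: \<rho>_def)
  have "(\<integral>\<^sup>+x. ennreal (exp (- arrival x k)) \<partial>exp_seq r) = ennreal (\<rho> ^ Suc k)" for k
  proof -
    have "(\<integral>\<^sup>+x. ennreal (exp (- arrival x k)) \<partial>exp_seq r) =
      (\<integral>\<^sup>+x. (\<Prod>i\<le>k. ennreal (exp (- 1 * x i))) \<partial>exp_seq r)"
      by (simp add: arrival_def prod_ennreal exp_sum sum_negf[symmetric])
    also have "\<dots> = ennreal \<rho> ^ Suc k"
      using nn_integral_exp_measure_exp[OF r, of 1] by (subst nn_integral_PiM_prod) (auto simp: \<rho>_def)
    finally show ?thesis using \<rho> by (simp only: ennreal_power)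
  qed
  then have "(\<integral>\<^sup>+x. (\<Sum>k. ennreal (exp (- arrival x k))) \<partial>exp_seq r) = (\<Sum>k. ennreal (\<rho> ^ Suc k))"
    by (subst nn_integral_suminf) (simp_all add: arrival_def)
  also have "\<dots> = ennreal (\<Sum>k. \<rho> ^ Suc k)"
    using \<rho> by (intro suminf_ennreal2) (auto intro!: summable_mult summable_geometric)
  finally have "AE x in exp_seq r. (\<Sum>k. ennreal (exp (- arrival x k))) \<noteq> \<infinity>"
    by (intro nn_integral_noteq_infinite) (simp_all add: arrival_def)
  then show ?thesis
  proof (eventually_elim, intro allI)
    fix x t assume "(\<Sum>k. ennreal (exp (- arrival x k))) \<noteq> \<infinity>"
    then have "(\<lambda>k. exp (- arrival x k)) \<longlonglongrightarrow> 0"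
      by (intro summable_LIMSEQ_zero summable_suminf_not_top) auto
    then have "\<forall>\<^sub>F k in cofinite. exp (- arrival x k) < exp (- t)"
      unfolding cofinite_eq_sequentially by (rule order_tendstoD) simp
    then show "finite {k. arrival x k \<le> t}"
      by (simp add: eventually_cofinite not_less)
  qed
qed

lemma AE_exp_seq_proper_waits:
  assumes r: "0 < r"
  shows "AE x in exp_seq r. proper_waits x"
proof -
  have "AE x in exp_seq r. 0 < x i" for i
    using AE_exp_measure_pos[OF r] by (intro AE_PiM_component prob_space_exponential_density r) auto
  then have "AE x in exp_seq r. \<forall>i. 0 < x i"
    by (simp add: AE_all_countable)
  with AE_exp_seq_finite_arrivals[OF r] show ?thesis
    by eventually_elim (simp add: proper_waits_def)
qed

lemma (in two_clocks) AE_proper_waits: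
  "AE \<omega> in exp_seq2 a b. proper_waits (fst \<omega>) \<and> proper_waits (snd \<omega>)"
proof -
  obtain S where S: "{x \<in> space (exp_seq a). \<not> proper_waits x} \<subseteq> S" "S \<in> null_sets (exp_seq a)"
    using AE_exp_seq_proper_waits[OF a_pos] by (auto elim!: AE_E simp: null_sets_def)
  obtain T where T: "{y \<in> space (exp_seq b). \<not> proper_waits y} \<subseteq> T" "T \<in> null_sets (exp_seq b)"
    using AE_exp_seq_proper_waits[OF b_pos] by (auto elim!: AE_E simp: null_sets_def)
  have "S \<times> space (exp_seq b) \<union> space (exp_seq a) \<times> T \<in> null_sets (exp_seq2 a b)"
    using B.P.times_in_null_sets1[OF S(2)] B.P.times_in_null_sets2[OF _ T(2)] by blast
  then show ?thesis
    by (rule AE_I') (use S(1) T(1) in \<open>auto simp: space_pair_measure\<close>)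
qed

section \<open>Measurability of first times\<close>

lemma at_left_rational_witness:
  fixes t :: real
  assumes "\<forall>\<^sub>F s in at_left t. P s"
  obtains r where "P (of_rat r)" "of_rat r < t"
proof -
  obtain b where b: "b < t" "\<And>s. b < s \<Longrightarrow> s < t \<Longrightarrow> P s"
    using assms by (auto simp: eventually_at_left_field)
  obtain r where "b < of_rat r" "of_rat r < t" using of_rat_dense[OF b(1)] by blast
  with b(2) show ?thesis by (intro that)
qed

text \<open>The infimum ranges over uncountably many times. It is measurable if \<open>D\<close> persists to the left
  of every time outside a countable family of random times: that family and the rationals then
  suffice as candidates.\<close>

lemma
  fixes D :: "'a \<Rightarrow> real \<Rightarrow> bool" and C :: "('a \<Rightarrow> real) set"
  assumes "countable C" "C \<subseteq> borel_measurable S" and bdd: "\<And>\<omega>. bdd_below {t. D \<omega> t}"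
    and pred: "\<And>c. c \<in> borel_measurable S \<Longrightarrow> Measurable.pred S (\<lambda>\<omega>. D \<omega> (c \<omega>))"
    and left: "\<And>\<omega> t. D \<omega> t \<Longrightarrow> t \<notin> (\<lambda>c. c \<omega>) ` C \<Longrightarrow> \<forall>\<^sub>F s in at_left t. D \<omega> s"
  shows pred_Ex_left_persistent: "Measurable.pred S (\<lambda>\<omega>. \<exists>t. D \<omega> t)"
    and borel_measurable_Inf_left_persistent: "(\<lambda>\<omega>. Inf {t. D \<omega> t}) \<in> borel_measurable S"
proof -
  define R where "R = C \<union> range (\<lambda>r \<omega>. of_rat r)"
  have R: "countable R" "\<And>c. c \<in> R \<Longrightarrow> c \<in> borel_measurable S"
    using assms(1,2) by (auto simp: R_def)
  have witness: "\<exists>c\<in>R. D \<omega> (c \<omega>) \<and> c \<omega> \<le> t" if D: "D \<omega> t" for \<omega> t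
  proof (cases "t \<in> (\<lambda>c. c \<omega>) ` C")
    case True
    then show ?thesis using D by (auto simp: R_def)
  next
    case False
    then obtain r where "D \<omega> (of_rat r)" "of_rat r < t"
      using at_left_rational_witness[OF left[OF D]] by blast
    then show ?thesis by (intro bexI[of _ "\<lambda>_. of_rat r"]) (auto simp: R_def)
  qed
  have Ex: "(\<exists>t. D \<omega> t) \<longleftrightarrow> (\<exists>c\<in>R. D \<omega> (c \<omega>))" for \<omega>
    using witness by blast
  then show "Measurable.pred S (\<lambda>\<omega>. \<exists>t. D \<omega> t)"
    using R pred by simp
  have less: "Inf {t. D \<omega> t} < a \<longleftrightarrow>
      (if \<exists>c\<in>R. D \<omega> (c \<omega>) then \<exists>c\<in>R. D \<omega> (c \<omega>) \<and> c \<omega> < a else Inf {} < a)" for \<omega> a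
  proof (cases "\<exists>t. D \<omega> t")
    case True
    then have "Inf {t. D \<omega> t} < a \<longleftrightarrow> (\<exists>t. D \<omega> t \<and> t < a)"
      by (subst cInf_less_iff) (auto intro: bdd)
    also have "\<dots> \<longleftrightarrow> (\<exists>c\<in>R. D \<omega> (c \<omega>) \<and> c \<omega> < a)"
      using witness by (meson le_less_trans)
    finally show ?thesis using True Ex by auto
  next
    case False
    then have "{t. D \<omega> t} = {}" by auto
    with False show ?thesis unfolding Ex by simp
  qed
  have "Measurable.pred S (\<lambda>\<omega>. Inf {t. D \<omega> t} < a)" for a
    unfolding less using R pred by measurable
  then show "(\<lambda>\<omega>. Inf {t. D \<omega> t}) \<in> borel_measurable S"
    unfolding borel_measurable_iff_less by (simp add: pred_def)
qed

lemma liminf_le_if_infinite: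
  assumes "infinite {k. X k \<le> t}"
  shows "liminf (\<lambda>k. ereal (X k)) \<le> ereal t"
proof (rule ccontr)
  assume "\<not> liminf (\<lambda>k. ereal (X k)) \<le> ereal t"
  then have "\<forall>\<^sub>F k in cofinite. t < X k"
    using less_LiminfD[of "ereal t" sequentially "\<lambda>k. ereal (X k)"] by (simp add: cofinite_eq_sequentially)
  with assms show False by (simp add: eventually_cofinite not_less)
qed

lemma infinite_if_liminf_less:
  assumes "liminf (\<lambda>k. ereal (X k)) < ereal t"
  shows "infinite {k. X k \<le> t}"
proof
  assume "finite {k. X k \<le> t}"
  then have "\<forall>\<^sub>F k in cofinite. ereal t \<le> ereal (X k)"
    by (auto simp: eventually_cofinite elim: finite_subset[rotated])
  then have "ereal t \<le> liminf (\<lambda>k. ereal (X k))"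
    unfolding cofinite_eq_sequentially by (rule Liminf_bounded)
  with assms show False by simp
qed

lemma counting_eventually_at_left:
  assumes "t \<notin> range X" "t \<noteq> real_of_ereal (liminf (\<lambda>k. ereal (X k)))"
  shows "\<forall>\<^sub>F s in at_left t. counting X s = counting X t"
proof (cases "finite {k. X k \<le> t}")
  case True
  have "\<forall>\<^sub>F s in at_left t. X k < s" if "X k \<le> t" for k
  proof -
    have "X k < t" using that assms(1) by (metis less_le rangeI)
    from eventually_at_left_real[OF this] show ?thesis by (auto elim: eventually_mono)
  qed
  then have "\<forall>\<^sub>F s in at_left t. \<forall>k\<in>{k. X k \<le> t}. X k < s"
    using True by (intro eventually_ball_finite) auto
  moreover have "\<forall>\<^sub>F s in at_left t. s < t"
    using eventually_at_left_real[of "t - 1" t] by (auto elim: eventually_mono)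
  ultimately show ?thesis
  proof eventually_elim
    case (elim s)
    then have "{k. X k \<le> s} = {k. X k \<le> t}" by force
    then show ?case by (simp add: counting_def)
  qed
next
  case False
  then have "liminf (\<lambda>k. ereal (X k)) < ereal t"
    using assms(2) liminf_le_if_infinite[of X t] by (metis less_le real_of_ereal.simps(1))
  then obtain r where r: "liminf (\<lambda>k. ereal (X k)) < ereal r" "r < t"
    using ereal_dense2 by fastforce
  then have "infinite {k. X k \<le> s}" if "r < s" for s
    using that by (intro infinite_if_liminf_less) (auto intro: less_trans)
  moreover have "\<forall>\<^sub>F s in at_left t. s \<in> {r<..<t}"
    using r(2) by (rule eventually_at_left_real)
  ultimately show ?thesis
    using r(2) by (auto simp: counting_def elim!: eventually_mono)
qed

lemma measurable_counting[measurable (raw)]: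
  assumes [measurable]: "\<And>k. (\<lambda>\<omega>. X \<omega> k) \<in> borel_measurable S" "T \<in> borel_measurable S"
  shows "(\<lambda>\<omega>. counting (X \<omega>) (T \<omega>)) \<in> measurable S (count_space UNIV)"
  unfolding counting_def by (rule measurable_card) simp

lemma measurable_arrival[measurable (raw)]:
  assumes [measurable]: "\<And>i. (\<lambda>\<omega>. x \<omega> i) \<in> borel_measurable S"
  shows "(\<lambda>\<omega>. arrival (x \<omega>) k) \<in> borel_measurable S"
  unfolding arrival_def by measurable

lemma measurable_compose_nat2:
  fixes f :: "'a \<Rightarrow> nat \<Rightarrow> nat \<Rightarrow> 'b"
  assumes "\<And>i j. (\<lambda>\<omega>. f \<omega> i j) \<in> S \<rightarrow>\<^sub>M R" "m \<in> S \<rightarrow>\<^sub>M count_space UNIV" "n \<in> S \<rightarrow>\<^sub>M count_space UNIV"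
  shows "(\<lambda>\<omega>. f \<omega> (m \<omega>) (n \<omega>)) \<in> S \<rightarrow>\<^sub>M R"
  by (rule measurable_compose_countable[OF _ assms(2)], rule measurable_compose_countable[OF _ assms(3)])
    (rule assms(1))

lemma
  fixes X Y :: "'a \<Rightarrow> nat \<Rightarrow> real" and start :: "'a \<Rightarrow> real" and Q :: "'a \<Rightarrow> nat \<Rightarrow> nat \<Rightarrow> bool"
  assumes [measurable]: "\<And>k. (\<lambda>\<omega>. X \<omega> k) \<in> borel_measurable S" "\<And>k. (\<lambda>\<omega>. Y \<omega> k) \<in> borel_measurable S"
      "start \<in> borel_measurable S"
    and Q: "\<And>n m. Measurable.pred S (\<lambda>\<omega>. Q \<omega> n m)"
  defines "D \<equiv> \<lambda>\<omega> t. start \<omega> \<le> t \<and> Q \<omega> (counting (X \<omega>) t) (counting (Y \<omega>) t)"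
  shows pred_Ex_counting: "Measurable.pred S (\<lambda>\<omega>. \<exists>t. D \<omega> t)"
    and borel_measurable_Inf_counting: "(\<lambda>\<omega>. Inf {t. D \<omega> t}) \<in> borel_measurable S"
proof -
  define C where "C = {start, \<lambda>\<omega>. real_of_ereal (liminf (\<lambda>k. ereal (X \<omega> k))),
      \<lambda>\<omega>. real_of_ereal (liminf (\<lambda>k. ereal (Y \<omega> k)))} \<union> range (\<lambda>k \<omega>. X \<omega> k) \<union> range (\<lambda>k \<omega>. Y \<omega> k)"
  have C: "countable C" "C \<subseteq> borel_measurable S" by (auto simp: C_def)
  have bdd: "bdd_below {t. D \<omega> t}" for \<omega> by (auto simp: bdd_below_def D_def)
  have pred: "Measurable.pred S (\<lambda>\<omega>. D \<omega> (c \<omega>))" if [measurable]: "c \<in> borel_measurable S" for c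
  proof -
    have "Measurable.pred S (\<lambda>\<omega>. Q \<omega> (counting (X \<omega>) (c \<omega>)) (counting (Y \<omega>) (c \<omega>)))"
      by (rule measurable_compose_nat2[where f=Q, OF Q]) measurable
    then show ?thesis unfolding D_def by measurable
  qed
  have left: "\<forall>\<^sub>F s in at_left t. D \<omega> s" if D: "D \<omega> t" and t: "t \<notin> (\<lambda>c. c \<omega>) ` C" for \<omega> t
  proof -
    have "start \<omega> < t" using D t by (auto simp: D_def C_def)
    then have "\<forall>\<^sub>F s in at_left t. start \<omega> < s"
      using eventually_at_left_real[of "start \<omega>" t] by (auto elim: eventually_mono)
    moreover have "\<forall>\<^sub>F s in at_left t. counting (X \<omega>) s = counting (X \<omega>) t"
      and "\<forall>\<^sub>F s in at_left t. counting (Y \<omega>) s = counting (Y \<omega>) t"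
      using t by (intro counting_eventually_at_left; auto simp: C_def)+
    ultimately show ?thesis
      by eventually_elim (use D in \<open>simp add: D_def\<close>)
  qed
  show "Measurable.pred S (\<lambda>\<omega>. \<exists>t. D \<omega> t)"
    by (rule pred_Ex_left_persistent[OF C bdd pred left])
  show "(\<lambda>\<omega>. Inf {t. D \<omega> t}) \<in> borel_measurable S"
    by (rule borel_measurable_Inf_left_persistent[OF C bdd pred left])
qed

section \<open>Rewards of stopped paths\<close>

definition stop_time :: "('s \<Rightarrow> bool) \<Rightarrow> (real \<Rightarrow> 's) \<Rightarrow> real" where
  "stop_time F X = Inf {t. 0 \<le> t \<and> F (X t)}"

text \<open>A path that never stops is worth \<open>c * \<infinity>\<close>, which is \<open>0\<close> if \<open>c = 0\<close>. With this convention the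
  one-step equation for expected rewards needs no termination argument.\<close>

definition stopped_reward :: "('s \<Rightarrow> bool) \<Rightarrow> real \<Rightarrow> ('s \<Rightarrow> real) \<Rightarrow> (real \<Rightarrow> 's) \<Rightarrow> ennreal" where
  "stopped_reward F c f X =
    (if \<exists>t. 0 \<le> t \<and> F (X t) then ennreal (c * stop_time F X + f (X (stop_time F X))) else ennreal c * \<top>)"

lemma stop_time_nonneg: "0 \<le> t \<Longrightarrow> F (X t) \<Longrightarrow> 0 \<le> stop_time F X"
  unfolding stop_time_def by (rule cInf_greatest) auto

lemma stopped_reward_stopped:
  assumes "F (X 0)"
  shows "stopped_reward F c f X = ennreal (f (X 0))"
proof -
  have "stop_time F X = 0"
    unfolding stop_time_def using assms by (intro cInf_eq_minimum) auto
  with assms show ?thesis by (auto simp: stopped_reward_def)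
qed

lemma stopped_reward_delay:
  assumes "0 \<le> u" "0 \<le> c" and f: "\<And>s. 0 \<le> f s"
    and before: "\<And>t. 0 \<le> t \<Longrightarrow> t < u \<Longrightarrow> \<not> F (X t)"
    and after: "\<And>t. 0 \<le> t \<Longrightarrow> X (u + t) = X' t"
  shows "stopped_reward F c f X = ennreal (c * u) + stopped_reward F c f X'"
proof -
  have "{t. 0 \<le> t \<and> F (X t)} = (+) u ` {t. 0 \<le> t \<and> F (X' t)}"
  proof (intro equalityI subsetI)
    fix t assume t: "t \<in> {t. 0 \<le> t \<and> F (X t)}"
    then have "u \<le> t" using before by force
    with t show "t \<in> (+) u ` {t. 0 \<le> t \<and> F (X' t)}"
      using after[of "t - u"] by (intro image_eqI[of _ _ "t - u"]) auto
  qed (use assms(1) after in auto)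
  note shift = this
  show ?thesis
  proof (cases "\<exists>t. 0 \<le> t \<and> F (X' t)")
    case True
    then have T: "0 \<le> stop_time F X'" using stop_time_nonneg by blast
    have "stop_time F X = u + stop_time F X'"
      unfolding stop_time_def shift
      using Inf_add_eq[of "\<lambda>t. t" "{t. 0 \<le> t \<and> F (X' t)}" u] True by (auto simp: bdd_below_def)
    moreover have "\<exists>t. 0 \<le> t \<and> F (X t)" using True assms(1) after by (metis add_nonneg_nonneg)
    ultimately show ?thesis
      using True T after assms(1,2) f by (simp add: stopped_reward_def ennreal_plus[symmetric]
        distrib_left add.assoc del: ennreal_plus)
  next
    case False
    with shift have "\<not> (\<exists>t. 0 \<le> t \<and> F (X t))" by blast
    with False show ?thesis using assms(1,2) by (cases "c = 0")
      (auto simp: stopped_reward_def ennreal_mult_top)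
  qed
qed

lemma
  fixes Z :: "'a \<Rightarrow> nat \<Rightarrow> nat \<Rightarrow> 's"
  assumes XY[measurable]: "\<And>k. (\<lambda>\<omega>. X \<omega> k) \<in> borel_measurable S" "\<And>k. (\<lambda>\<omega>. Y \<omega> k) \<in> borel_measurable S"
    and Z: "\<And>n m. (\<lambda>\<omega>. Z \<omega> n m) \<in> S \<rightarrow>\<^sub>M count_space UNIV"
  shows borel_measurable_stopped_reward:
    "(\<lambda>\<omega>. stopped_reward F c f (\<lambda>t. Z \<omega> (counting (X \<omega>) t) (counting (Y \<omega>) t))) \<in> borel_measurable S"
proof -
  define P where "P \<omega> t = Z \<omega> (counting (X \<omega>) t) (counting (Y \<omega>) t)" for \<omega> t
  have F: "Measurable.pred S (\<lambda>\<omega>. F (Z \<omega> n m))" for n m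
    using measurable_compose[OF Z, of F] by simp
  have [measurable]: "Measurable.pred S (\<lambda>\<omega>. \<exists>t. 0 \<le> t \<and> F (P \<omega> t))"
    unfolding P_def by (rule pred_Ex_counting[where start="\<lambda>_. 0" and Q="\<lambda>\<omega> n m. F (Z \<omega> n m)"])
      (use F in simp_all)
  have [measurable]: "(\<lambda>\<omega>. stop_time F (P \<omega>)) \<in> borel_measurable S"
    unfolding stop_time_def P_def
    by (rule borel_measurable_Inf_counting[where start="\<lambda>_. 0" and Q="\<lambda>\<omega> n m. F (Z \<omega> n m)"])
      (use F in simp_all)
  have "(\<lambda>\<omega>. f (Z \<omega> n m)) \<in> borel_measurable S" for n m
    using measurable_compose[OF Z, of f] by simp
  then have [measurable]: "(\<lambda>\<omega>. f (P \<omega> (stop_time F (P \<omega>)))) \<in> borel_measurable S"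
    unfolding P_def[of _ "stop_time F _"]
    by (rule measurable_compose_nat2[where f="\<lambda>\<omega> n m. f (Z \<omega> n m)"]) measurable
  have "(\<lambda>\<omega>. stopped_reward F c f (P \<omega>)) \<in> borel_measurable S"
    unfolding stopped_reward_def by measurable
  then show ?thesis by (simp add: P_def[abs_def])
qed

section \<open>The race between the official chain and the secret fork\<close>

text \<open>A state \<open>(h, s)\<close> counts the official blocks after the fork point and the secret blocks. Pre-mining
  is the state \<open>(0, 0)\<close>, in which an honest block only moves the fork point.\<close>

type_synonym race_state = "nat \<times> nat"

definition honest_block :: "race_state \<Rightarrow> race_state" where
  "honest_block st = (case st of (h, s) \<Rightarrow> (if s = 0 then h else Suc h, s))"

definition attacker_block :: "race_state \<Rightarrow> race_state" where
  "attacker_block st = (case st of (h, s) \<Rightarrow> (h, Suc s))"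

definition race_over :: "nat \<Rightarrow> nat \<Rightarrow> race_state \<Rightarrow> bool" where
  "race_over A z st \<longleftrightarrow> (case st of (h, s) \<Rightarrow> h = s + A \<or> z \<le> h \<and> h < s)"

text \<open>Truncated subtraction: while the pre-mined block is pending the difference is \<open>0\<close>.\<close>

definition race_path :: "race_state \<Rightarrow> (nat \<Rightarrow> real) \<times> (nat \<Rightarrow> real) \<Rightarrow> real \<Rightarrow> race_state" where
  "race_path st \<omega> t = (case st of (h, s) \<Rightarrow>
     (h + (counting (arrival (fst \<omega>)) t - (if s = 0 then counting (arrival (fst \<omega>)) (snd \<omega> 0) else 0)),
      s + counting (arrival (snd \<omega>)) t))"

lemma race_path_0: "proper_waits x \<Longrightarrow> proper_waits y \<Longrightarrow> race_path st (x, y) 0 = st"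
  by (simp add: race_path_def counting_eq_0 arrival_pos split: prod.split)

lemma counting_case_nat_before:
  assumes "proper_waits x" "t < u"
  shows "counting (arrival (case_nat u x)) t = 0"
proof (rule counting_eq_0)
  show "t < arrival (case_nat u x) k" for k
  proof (cases k)
    case 0
    then show ?thesis using assms by (simp add: arrival_def)
  next
    case (Suc n)
    then show ?thesis using assms arrival_pos[of x n] by (simp add: arrival_case_nat_Suc)
  qed
qed

lemma counting_delay_before: "proper_waits x \<Longrightarrow> t \<le> u \<Longrightarrow> counting (arrival (delay u x)) t = 0"
  using arrival_pos[of x] by (intro counting_eq_0) (auto simp: arrival_delay intro: le_less_trans)

lemma race_path_before_first_block:
  assumes "proper_waits x" "proper_waits y" "t < u"
  shows "race_path st (case_nat u x, delay u y) t = st" "race_path st (delay u x, case_nat u y) t = st"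
  using assms by (simp_all add: race_path_def counting_case_nat_before counting_delay_before
    split: prod.split)

lemma race_path_honest_block:
  assumes "proper_waits x" "proper_waits y" "0 \<le> t"
  shows "race_path st (case_nat u x, delay u y) (u + t) = race_path (honest_block st) (x, y) t"
proof -
  have "0 \<le> y 0" using assms(2) by (simp add: proper_waits_def less_imp_le)
  with assms have "counting (arrival (case_nat u x)) (delay u y 0) = Suc (counting (arrival x) (y 0))"
    by (simp add: delay_def counting_case_nat)
  with assms show ?thesis
    by (simp add: race_path_def honest_block_def counting_case_nat counting_delay split: prod.split)
qed

lemma race_path_attacker_block:
  assumes "proper_waits x" "proper_waits y" "0 \<le> t"
  shows "race_path st (delay u x, case_nat u y) (u + t) = race_path (attacker_block st) (x, y) t"
  using assms by (simp add: race_path_def attacker_block_def counting_case_nat counting_delay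
      counting_delay_before split: prod.split)

section \<open>Expected rewards as solutions of the one-step equation\<close>

lemma lyapunov_max_principle:
  fixes D G :: "'s \<Rightarrow> real"
  assumes "0 \<le> p" "0 \<le> q" "0 \<le> \<theta>" "\<theta> < 1" "0 \<le> B"
    and G: "\<And>s. s \<in> S \<Longrightarrow> 0 \<le> G s"
    and closed: "\<And>s. s \<in> S \<Longrightarrow> \<not> F s \<Longrightarrow> \<sigma> s \<in> S \<and> \<tau> s \<in> S"
    and contraction: "\<And>s. s \<in> S \<Longrightarrow> \<not> F s \<Longrightarrow> p * G (\<sigma> s) + q * G (\<tau> s) \<le> \<theta> * G s"
    and growth: "\<And>s. s \<in> S \<Longrightarrow> D s \<le> B * G s"
    and final: "\<And>s. s \<in> S \<Longrightarrow> F s \<Longrightarrow> D s \<le> 0"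
    and step: "\<And>s. s \<in> S \<Longrightarrow> \<not> F s \<Longrightarrow> D s \<le> p * D (\<sigma> s) + q * D (\<tau> s)"
    and "s \<in> S"
  shows "D s \<le> 0"
proof -
  have "D s \<le> B * \<theta> ^ n * G s" if "s \<in> S" for n s
    using that
  proof (induction n arbitrary: s)
    case 0
    then show ?case using growth by simp
  next
    case (Suc n)
    show ?case
    proof (cases "F s")
      case True
      moreover have "0 \<le> B * \<theta> ^ Suc n * G s"
        using G[OF Suc.prems] assms(3,5) by (intro mult_nonneg_nonneg) auto
      ultimately show ?thesis using final[OF Suc.prems] by linarith
    next
      case False
      have "D s \<le> p * D (\<sigma> s) + q * D (\<tau> s)" by (rule step[OF Suc.prems False])
      also have "\<dots> \<le> p * (B * \<theta> ^ n * G (\<sigma> s)) + q * (B * \<theta> ^ n * G (\<tau> s))"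
        using closed[OF Suc.prems False] Suc.IH assms(1,2) by (intro add_mono mult_left_mono) auto
      also have "\<dots> = B * \<theta> ^ n * (p * G (\<sigma> s) + q * G (\<tau> s))" by (simp add: algebra_simps)
      also have "\<dots> \<le> B * \<theta> ^ n * (\<theta> * G s)"
        using contraction[OF Suc.prems False] assms(3,5) by (intro mult_left_mono) auto
      finally show ?thesis by (simp add: mult_ac)
    qed
  qed
  moreover have "(\<lambda>n. B * \<theta> ^ n * G s) \<longlonglongrightarrow> B * 0 * G s"
    using assms(3,4) by (intro tendsto_intros LIMSEQ_power_zero) auto
  ultimately show ?thesis
    using \<open>s \<in> S\<close> LIMSEQ_le_const[of "\<lambda>n. B * \<theta> ^ n * G s" 0 "D s"] by simp
qed

lemma ennreal_enn2real_le: "x \<le> ennreal r \<Longrightarrow> x = ennreal (enn2real x)"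
  using ennreal_enn2real[of x] le_less_trans[OF _ ennreal_less_top] by simp

lemma nn_integral_le_min:
  fixes f :: "'a \<Rightarrow> ennreal"
  assumes [measurable]: "f \<in> borel_measurable M"
    and le: "\<And>n :: nat. (\<integral>\<^sup>+x. min (f x) (of_nat n) \<partial>M) \<le> C"
  shows "(\<integral>\<^sup>+x. f x \<partial>M) \<le> C"
proof -
  have "f x = (SUP n. min (f x) (of_nat n))" for x
    using inf_SUP[of "f x" "of_nat :: nat \<Rightarrow> ennreal" UNIV]
    by (simp add: ennreal_SUP_of_nat_eq_top inf_min)
  then have "(\<integral>\<^sup>+x. f x \<partial>M) = (\<integral>\<^sup>+x. (SUP n. min (f x) (of_nat n)) \<partial>M)" by simp
  also have "\<dots> = (SUP n. \<integral>\<^sup>+x. min (f x) (of_nat n) \<partial>M)"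
    by (intro nn_integral_monotone_convergence_SUP)
      (auto simp: incseq_def le_fun_def intro: min.coboundedI2)
  also have "\<dots> \<le> C" using le by (intro SUP_least) auto
  finally show ?thesis .
qed

locale mining =
  fixes q p tau0 :: real and A z :: nat
  assumes q_pos: "0 < q" and q_less_p: "q < p" and p_plus_q: "p + q = 1" and tau0_pos: "0 < tau0"
    and z_pos: "1 \<le> z" and z_le_A: "z \<le> A"
begin

lemma p_pos: "0 < p"
  using q_pos q_less_p by simp

sublocale two_clocks "p / tau0" "q / tau0"
  using p_pos q_pos tau0_pos by unfold_locales simp_all

abbreviation "N \<equiv> exp_seq2 (p / tau0) (q / tau0)"

definition race_states :: "race_state set" where
  "race_states = {(h, s). h \<le> s + A \<and> (s = 0 \<longrightarrow> h = 0)}"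

lemma race_states_closed:
  assumes "st \<in> race_states" "\<not> race_over A z st"
  shows "honest_block st \<in> race_states \<and> attacker_block st \<in> race_states"
  using assms by (auto simp: race_states_def race_over_def honest_block_def attacker_block_def)

definition race_value :: "real \<Rightarrow> (race_state \<Rightarrow> real) \<Rightarrow> race_state \<Rightarrow>
    (nat \<Rightarrow> real) \<times> (nat \<Rightarrow> real) \<Rightarrow> ennreal" where
  "race_value c f st \<omega> = stopped_reward (race_over A z) c f (race_path st \<omega>)"

definition one_step_solution :: "real \<Rightarrow> (race_state \<Rightarrow> real) \<Rightarrow> (race_state \<Rightarrow> real) \<Rightarrow> bool" where
  "one_step_solution c f W \<longleftrightarrow>
     (\<forall>st\<in>race_states. W st =
       (if race_over A z st then f st else c * tau0 + p * W (honest_block st) + q * W (attacker_block st))) \<and>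
     (\<exists>C. \<forall>st\<in>race_states. \<bar>W st\<bar> \<le> C * (1 + real (snd st)))"

text \<open>Any ratio between the roots \<open>1\<close> and \<open>p / q\<close> of \<open>q * x\<^sup>2 - x + p\<close> makes \<open>x ^ (s - h)\<close> a strict
  supersolution; the midpoint \<open>1 / (2 * q)\<close> of the roots is used. The linear factor absorbs
  rewards of linear growth.\<close>

definition lyapunov :: "race_state \<Rightarrow> real" where
  "lyapunov st = (case st of (h, s) \<Rightarrow>
     if s = 0 then 2 * (2 / (p - q)\<^sup>2 + 1) * (1 / (2 * q)) ^ (A + 1)
     else (2 / (p - q)\<^sup>2 + real s) * (1 / (2 * q)) ^ (s + A - h))"

lemma lyapunov_growth: "1 + real (snd st) \<le> lyapunov st"
proof -
  define K where "K = 2 / (p - q)\<^sup>2"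
  define x where "x = 1 / (2 * q)"
  have "(p - q)\<^sup>2 \<le> 1" using q_pos q_less_p p_plus_q by (simp add: power_le_one)
  then have K: "1 \<le> K" using q_less_p by (simp add: K_def)
  have x: "1 \<le> x" using q_pos q_less_p p_plus_q by (simp add: x_def)
  obtain h s where st: "st = (h, s)" by fastforce
  show ?thesis
  proof (cases "s = 0")
    case True
    have "1 * 1 \<le> 2 * (K + 1) * x ^ (A + 1)" using K x by (intro mult_mono one_le_power) auto
    then show ?thesis using True by (simp add: st lyapunov_def flip: K_def x_def)
  next
    case False
    have "(1 + real s) * 1 \<le> (K + real s) * x ^ (s + A - h)"
      using K x by (intro mult_mono one_le_power) auto
    then show ?thesis using False by (simp add: st lyapunov_def flip: K_def x_def)
  qed
qed

lemma lyapunov_linear_factor: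
  fixes s :: real
  assumes "0 \<le> s"
  defines "K \<equiv> 2 / (p - q)\<^sup>2"
  shows "2 * p * q * (K + s) + (K + s + 1) / 2 \<le> (1 - q * (p - q)\<^sup>2 / 4) * (K + s)"
proof -
  define \<delta> where "\<delta> = (p - q)\<^sup>2 / 4"
  have \<delta>: "0 \<le> \<delta>" "K * \<delta> = 1/2" using q_less_p by (auto simp: \<delta>_def K_def)
  have pq: "2 * p * q = 1/2 - 2 * \<delta>"
    unfolding \<delta>_def using p_plus_q by algebra
  have "2 * p * q * (K + s) + (K + s + 1) / 2 = (K + s) * (1 - 2 * \<delta>) + K * \<delta>"
    unfolding pq \<delta>(2) by (simp add: algebra_simps add_divide_distrib)
  also have "\<dots> \<le> (1 - \<delta>) * (K + s)"
    using assms(1) \<delta>(1) by (simp add: algebra_simps)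
  also have "\<dots> \<le> (1 - q * \<delta>) * (K + s)"
    using \<delta>(1) q_pos q_less_p p_plus_q assms(1) mult_right_mono[of q 1 \<delta>]
    by (intro mult_right_mono) (auto simp: K_def)
  finally show ?thesis by (simp add: \<delta>_def)
qed

lemma lyapunov_contraction_premining:
  "p * lyapunov (0, 0) + q * lyapunov (0, 1) \<le> (1 - q * (p - q)\<^sup>2 / 4) * lyapunov (0, 0)"
proof -
  define K where "K = 2 / (p - q)\<^sup>2"
  define x where "x = 1 / (2 * q)"
  have lyapunov: "lyapunov (0, 0) = 2 * lyapunov (0, 1)"
    by (simp add: lyapunov_def mult.assoc flip: K_def x_def)
  have "(p - q)\<^sup>2 \<le> 1" using q_pos q_less_p p_plus_q by (simp add: power_le_one)
  then have "q * (p - q)\<^sup>2 \<le> q" using mult_left_mono[of "(p - q)\<^sup>2" 1 q] q_pos by simp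
  then have "p * 2 + q \<le> (1 - q * (p - q)\<^sup>2 / 4) * 2" using q_pos p_plus_q by argo
  then have "(p * 2 + q) * lyapunov (0, 1) \<le> (1 - q * (p - q)\<^sup>2 / 4) * 2 * lyapunov (0, 1)"
    using lyapunov_growth[of "(0, 1)"] by (intro mult_right_mono) auto
  then show ?thesis unfolding lyapunov by (simp only: distrib_right mult.assoc)
qed

lemma lyapunov_contraction_forked:
  assumes "0 < s" "h < s + A"
  shows "p * lyapunov (Suc h, s) + q * lyapunov (h, Suc s) \<le> (1 - q * (p - q)\<^sup>2 / 4) * lyapunov (h, s)"
proof -
  define K where "K = 2 / (p - q)\<^sup>2"
  define x where "x = 1 / (2 * q)"
  define m where "m = s + A - Suc h"
  have x: "0 < x" "q * x = 1/2" using q_pos by (auto simp: x_def)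
  have "s + A - h = Suc m" "s + A - Suc h = m" "Suc (s + A) - h = Suc (Suc m)"
    using assms(2) by (simp_all add: m_def)
  then have lyapunov: "lyapunov (Suc h, s) = (K + real s) * x ^ m"
    "lyapunov (h, Suc s) = (K + real (Suc s)) * x ^ Suc (Suc m)" "lyapunov (h, s) = (K + real s) * x ^ Suc m"
    using assms(1) by (simp_all add: lyapunov_def flip: K_def x_def)
  have "p * ((K + real s) * x ^ m) = 2 * (q * x) * (p * ((K + real s) * x ^ m))"
    unfolding x(2) by simp
  moreover have "q * ((K + real (Suc s)) * x ^ Suc (Suc m)) = (q * x) * ((K + real s + 1) * x ^ Suc m)"
    by (simp add: mult_ac add_ac)
  ultimately have "p * lyapunov (Suc h, s) + q * lyapunov (h, Suc s)
      = 2 * (q * x) * (p * ((K + real s) * x ^ m)) + (q * x) * ((K + real s + 1) * x ^ Suc m)"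
    unfolding lyapunov by (rule arg_cong2[where f="(+)"])
  also have "(q * x) * ((K + real s + 1) * x ^ Suc m) = (K + real s + 1) / 2 * x ^ Suc m"
    unfolding x(2) by simp
  also have "2 * (q * x) * (p * ((K + real s) * x ^ m)) + (K + real s + 1) / 2 * x ^ Suc m
      = (2 * p * q * (K + real s) + (K + real s + 1) / 2) * x ^ Suc m"
    unfolding distrib_right[of "2 * p * q * (K + real s)"] by (simp add: mult_ac)
  also have "\<dots> \<le> (1 - q * (p - q)\<^sup>2 / 4) * (K + real s) * x ^ Suc m"
    using lyapunov_linear_factor[of "real s"] x(1) unfolding K_def by (intro mult_right_mono) auto
  finally show ?thesis by (simp add: lyapunov mult.assoc)
qed

lemma lyapunov_contraction:
  assumes "st \<in> race_states" "\<not> race_over A z st"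
  shows "p * lyapunov (honest_block st) + q * lyapunov (attacker_block st)
    \<le> (1 - q * (p - q)\<^sup>2 / 4) * lyapunov st"
proof -
  obtain h s where st: "st = (h, s)" by fastforce
  show ?thesis
  proof (cases "s = 0")
    case True
    with assms(1) have "st = (0, 0)" by (simp add: st race_states_def)
    then show ?thesis
      using lyapunov_contraction_premining by (simp add: honest_block_def attacker_block_def)
  next
    case False
    then have "h < s + A" using assms by (auto simp: st race_states_def race_over_def)
    then show ?thesis
      using False lyapunov_contraction_forked[of s h] by (simp add: st honest_block_def attacker_block_def)
  qed
qed

lemma one_step_max_principle:
  assumes growth: "\<And>st. st \<in> race_states \<Longrightarrow> D st \<le> C * (1 + real (snd st))"
    and "\<And>st. st \<in> race_states \<Longrightarrow> race_over A z st \<Longrightarrow> D st \<le> 0"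
    and "\<And>st. st \<in> race_states \<Longrightarrow> \<not> race_over A z st \<Longrightarrow>
      D st \<le> p * D (honest_block st) + q * D (attacker_block st)"
    and "st \<in> race_states"
  shows "D st \<le> 0"
proof (rule lyapunov_max_principle[where p=p and q=q and G=lyapunov and \<theta>="1 - q * (p - q)\<^sup>2 / 4" and B="\<bar>C\<bar>"
      and S=race_states and F="race_over A z" and \<sigma>=honest_block and \<tau>=attacker_block])
  have "q * (p - q)\<^sup>2 \<le> 1 * 1"
    using q_pos q_less_p p_plus_q by (intro mult_mono) (auto simp: power_le_one)
  then show "0 \<le> 1 - q * (p - q)\<^sup>2 / 4" by simp
  show "1 - q * (p - q)\<^sup>2 / 4 < 1" using q_pos q_less_p by simp
  show "0 \<le> lyapunov st" for st using lyapunov_growth[of st] by linarith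
  show "D st \<le> \<bar>C\<bar> * lyapunov st" if "st \<in> race_states" for st
  proof -
    have "D st \<le> \<bar>C\<bar> * (1 + real (snd st))"
      using growth[OF that] abs_ge_self[of C] mult_right_mono[of C "\<bar>C\<bar>" "1 + real (snd st)"] by linarith
    also have "\<dots> \<le> \<bar>C\<bar> * lyapunov st" by (intro mult_left_mono lyapunov_growth) simp
    finally show ?thesis .
  qed
qed (use assms p_pos q_pos race_states_closed lyapunov_contraction in auto)

lemma measurable_race_value[measurable]: "race_value c f st \<in> borel_measurable N"
proof -
  obtain h s where st: "st = (h, s)" by fastforce
  have [measurable]: "(\<lambda>\<omega>. fst \<omega> i) \<in> borel_measurable N" "(\<lambda>\<omega>. snd \<omega> i) \<in> borel_measurable N" for i
    by (auto intro!: measurable_compose[OF measurable_fst] measurable_compose[OF measurable_snd]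
        measurable_component_singleton[of i UNIV "\<lambda>_. exp_measure _", simplified])
  show ?thesis
    unfolding race_value_def race_path_def st prod.case
    by (rule borel_measurable_stopped_reward[where X="\<lambda>\<omega>. arrival (fst \<omega>)" and Y="\<lambda>\<omega>. arrival (snd \<omega>)"
          and Z="\<lambda>\<omega> n m. (h + (n - (if s = 0 then counting (arrival (fst \<omega>)) (snd \<omega> 0) else 0)), s + m)"])
      measurable
qed

lemma nn_integral_race_over:
  assumes "race_over A z st"
  shows "(\<integral>\<^sup>+\<omega>. g (race_value c f st \<omega>) \<partial>N) = g (ennreal (f st))"
proof -
  have "(\<integral>\<^sup>+\<omega>. g (race_value c f st \<omega>) \<partial>N) = (\<integral>\<^sup>+\<omega>. g (ennreal (f st)) \<partial>N)"
    using AE_proper_waits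
  proof (intro nn_integral_cong_AE, eventually_elim)
    case (elim \<omega>)
    then have "race_path st \<omega> 0 = st" using race_path_0[of "fst \<omega>" "snd \<omega>"] by simp
    then show ?case
      using assms by (simp add: race_value_def stopped_reward_stopped)
  qed
  then show ?thesis by (simp add: emeasure_space_1)
qed

lemma race_value_first_block:
  assumes "\<not> race_over A z st" "0 \<le> c" "\<And>st. 0 \<le> f st" "0 < u" "proper_waits x" "proper_waits y"
  shows "race_value c f st (case_nat u x, delay u y) =
      ennreal (c * u) + race_value c f (honest_block st) (x, y)"
    and "race_value c f st (delay u x, case_nat u y) =
      ennreal (c * u) + race_value c f (attacker_block st) (x, y)"
  unfolding race_value_def using assms
  by (auto intro!: stopped_reward_delay simp: race_path_before_first_block
      race_path_honest_block race_path_attacker_block)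

lemma nn_integral_first_wait_add:
  assumes [measurable]: "G \<in> borel_measurable N" and "0 \<le> c"
  shows "(\<integral>\<^sup>+u. \<integral>\<^sup>+\<omega>. ennreal (c * u) + G \<omega> \<partial>N \<partial>exp_measure (1 / tau0)) =
      ennreal (c * tau0) + (\<integral>\<^sup>+\<omega>. G \<omega> \<partial>N)"
proof -
  interpret E: prob_space "exp_measure (1 / tau0)"
    using tau0_pos by (intro prob_space_exponential_density) simp
  show ?thesis
    using nn_integral_exp_measure_linear[of "1 / tau0" c] assms(2) tau0_pos
    by (simp add: nn_integral_add emeasure_space_1 E.emeasure_space_1 del: space_density)
qed

lemma nn_integral_race_value_first_block:
  assumes "\<not> race_over A z st" "0 \<le> c" "\<And>st. 0 \<le> f st"
  shows "(\<integral>\<^sup>+\<omega>. min (race_value c f st \<omega>) K \<partial>N) =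
      ennreal p * (\<integral>\<^sup>+u. \<integral>\<^sup>+\<omega>. min (ennreal (c * u) + race_value c f (honest_block st) \<omega>) K
          \<partial>N \<partial>exp_measure (1 / tau0))
    + ennreal q * (\<integral>\<^sup>+u. \<integral>\<^sup>+\<omega>. min (ennreal (c * u) + race_value c f (attacker_block st) \<omega>) K
          \<partial>N \<partial>exp_measure (1 / tau0))"
proof -
  have rates: "p / tau0 + q / tau0 = 1 / tau0" "p / tau0 / (1 / tau0) = p" "q / tau0 / (1 / tau0) = q"
    using tau0_pos p_plus_q by (auto simp: add_divide_distrib[symmetric])
  have first_block:
    "(\<integral>\<^sup>+\<omega>. min (race_value c f st (case_nat u (fst \<omega>), delay u (snd \<omega>))) K \<partial>N)
      = (\<integral>\<^sup>+\<omega>. min (ennreal (c * u) + race_value c f (honest_block st) \<omega>) K \<partial>N)"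
    "(\<integral>\<^sup>+\<omega>. min (race_value c f st (delay u (fst \<omega>), case_nat u (snd \<omega>))) K \<partial>N)
      = (\<integral>\<^sup>+\<omega>. min (ennreal (c * u) + race_value c f (attacker_block st) \<omega>) K \<partial>N)"
    if "0 < u" for u
    using AE_proper_waits
    by (intro nn_integral_cong_AE, eventually_elim, simp add: race_value_first_block[OF assms that])+
  have pos: "AE u in exp_measure (1 / tau0). 0 < u"
    using tau0_pos by (intro AE_exp_measure_pos) simp
  have "(\<integral>\<^sup>+\<omega>. min (race_value c f st \<omega>) K \<partial>N) =
      ennreal p * (\<integral>\<^sup>+u. \<integral>\<^sup>+\<omega>. min (race_value c f st (case_nat u (fst \<omega>), delay u (snd \<omega>))) K
          \<partial>N \<partial>exp_measure (1 / tau0))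
    + ennreal q * (\<integral>\<^sup>+u. \<integral>\<^sup>+\<omega>. min (race_value c f st (delay u (fst \<omega>), case_nat u (snd \<omega>))) K
          \<partial>N \<partial>exp_measure (1 / tau0))"
    by (subst nn_integral_first_block, measurable) (simp only: rates)
  also have "\<dots> =
      ennreal p * (\<integral>\<^sup>+u. \<integral>\<^sup>+\<omega>. min (ennreal (c * u) + race_value c f (honest_block st) \<omega>) K
          \<partial>N \<partial>exp_measure (1 / tau0))
    + ennreal q * (\<integral>\<^sup>+u. \<integral>\<^sup>+\<omega>. min (ennreal (c * u) + race_value c f (attacker_block st) \<omega>) K
          \<partial>N \<partial>exp_measure (1 / tau0))"
    using nn_integral_cong_AE[OF eventually_mono[OF pos first_block(1)]]
      nn_integral_cong_AE[OF eventually_mono[OF pos first_block(2)]] by simp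
  finally show ?thesis .
qed

lemma nn_integral_race_value_step:
  assumes "\<not> race_over A z st" "0 \<le> c" "\<And>st. 0 \<le> f st"
  shows "(\<integral>\<^sup>+\<omega>. race_value c f st \<omega> \<partial>N) =
      ennreal p * (ennreal (c * tau0) + (\<integral>\<^sup>+\<omega>. race_value c f (honest_block st) \<omega> \<partial>N))
    + ennreal q * (ennreal (c * tau0) + (\<integral>\<^sup>+\<omega>. race_value c f (attacker_block st) \<omega> \<partial>N))"
  using nn_integral_race_value_first_block[OF assms, where K=\<top>] assms(2)
  by (simp add: nn_integral_first_wait_add)

lemma nn_integral_min_race_value_step:
  assumes "\<not> race_over A z st" "0 \<le> c" "\<And>st. 0 \<le> f st"
  shows "(\<integral>\<^sup>+\<omega>. min (race_value c f st \<omega>) K \<partial>N) \<le>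
      ennreal p * (ennreal (c * tau0) + (\<integral>\<^sup>+\<omega>. min (race_value c f (honest_block st) \<omega>) K \<partial>N))
    + ennreal q * (ennreal (c * tau0) + (\<integral>\<^sup>+\<omega>. min (race_value c f (attacker_block st) \<omega>) K \<partial>N))"
proof -
  have "min (a + v) K \<le> a + min v K" for a v :: ennreal
    by (cases rule: le_cases[of v K]) (simp_all add: min_absorb1 min_absorb2 min.coboundedI2 add_increasing)
  then have "(\<integral>\<^sup>+u. \<integral>\<^sup>+\<omega>. min (ennreal (c * u) + race_value c f st' \<omega>) K \<partial>N \<partial>exp_measure (1 / tau0))
      \<le> ennreal (c * tau0) + (\<integral>\<^sup>+\<omega>. min (race_value c f st' \<omega>) K \<partial>N)" for st'
    using assms(2) by (subst nn_integral_first_wait_add[symmetric]) (auto intro!: nn_integral_mono)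
  then show ?thesis
    unfolding nn_integral_race_value_first_block[OF assms] by (intro add_mono mult_left_mono) auto
qed

lemma ennreal_one_step:
  assumes "0 \<le> c" "0 \<le> a" "0 \<le> b"
  shows "ennreal p * (ennreal (c * tau0) + ennreal a) + ennreal q * (ennreal (c * tau0) + ennreal b)
    = ennreal (c * tau0 + p * a + q * b)"
proof -
  have "p * (c * tau0 + a) + q * (c * tau0 + b) = (p + q) * (c * tau0) + p * a + q * b"
    by (simp only: distrib_left distrib_right add_ac)
  then show ?thesis
    using assms p_pos q_pos tau0_pos p_plus_q
    by (simp add: ennreal_mult[symmetric] ennreal_plus[symmetric] del: ennreal_plus)
qed

context
  fixes c :: real and f W :: "race_state \<Rightarrow> real"
  assumes c: "0 \<le> c" and f: "\<And>st. 0 \<le> f st" and W: "one_step_solution c f W"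
begin

lemma one_step_solution_over: "st \<in> race_states \<Longrightarrow> race_over A z st \<Longrightarrow> W st = f st"
  and one_step_solution_step: "st \<in> race_states \<Longrightarrow> \<not> race_over A z st \<Longrightarrow>
    W st = c * tau0 + p * W (honest_block st) + q * W (attacker_block st)"
  using W by (auto simp: one_step_solution_def)

lemma one_step_solution_growth:
  obtains C where "0 \<le> C" "\<And>st. st \<in> race_states \<Longrightarrow> \<bar>W st\<bar> \<le> C * (1 + real (snd st))"
proof -
  obtain C where C: "\<And>st. st \<in> race_states \<Longrightarrow> \<bar>W st\<bar> \<le> C * (1 + real (snd st))"
    using W unfolding one_step_solution_def by blast
  moreover have "0 \<le> C" using C[of "(0, 0)"] by (auto simp: race_states_def)
  ultimately show ?thesis by (rule that[rotated])
qed

lemma one_step_solution_nonneg: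
  assumes "st \<in> race_states"
  shows "0 \<le> W st"
proof -
  obtain C where C: "\<And>st. st \<in> race_states \<Longrightarrow> \<bar>W st\<bar> \<le> C * (1 + real (snd st))"
    using one_step_solution_growth by blast
  have "- W st \<le> 0"
  proof (rule one_step_max_principle[where C=C])
    show "- W st \<le> C * (1 + real (snd st))" if "st \<in> race_states" for st
      using C[OF that] by linarith
    show "- W st \<le> p * - W (honest_block st) + q * - W (attacker_block st)"
      if "st \<in> race_states" "\<not> race_over A z st" for st
      using one_step_solution_step[OF that] mult_nonneg_nonneg[OF c less_imp_le[OF tau0_pos]] by simp
  qed (use assms f one_step_solution_over in auto)
  then show ?thesis by simp
qed

lemma nn_integral_min_race_value_le:
  assumes "st \<in> race_states" "0 \<le> K"
  shows "(\<integral>\<^sup>+\<omega>. min (race_value c f st \<omega>) (ennreal K) \<partial>N) \<le> ennreal (W st)"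
proof -
  define w where "w st = enn2real (\<integral>\<^sup>+\<omega>. min (race_value c f st \<omega>) (ennreal K) \<partial>N)" for st
  have le_K: "(\<integral>\<^sup>+\<omega>. min (race_value c f st \<omega>) (ennreal K) \<partial>N) \<le> ennreal K" for st
    using nn_integral_mono[of N "\<lambda>\<omega>. min (race_value c f st \<omega>) (ennreal K)" "\<lambda>_. ennreal K"]
    by (simp add: emeasure_space_1)
  then have w: "(\<integral>\<^sup>+\<omega>. min (race_value c f st \<omega>) (ennreal K) \<partial>N) = ennreal (w st)" for st
    unfolding w_def by (rule ennreal_enn2real_le)
  have w_nonneg: "0 \<le> w st" for st by (simp add: w_def)
  obtain C where C: "0 \<le> C" "\<And>st. st \<in> race_states \<Longrightarrow> \<bar>W st\<bar> \<le> C * (1 + real (snd st))"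
    using one_step_solution_growth by blast
  have "w st - W st \<le> 0"
  proof (rule one_step_max_principle[where C="K + C"])
    show "w st - W st \<le> (K + C) * (1 + real (snd st))" if "st \<in> race_states" for st
    proof -
      have "w st \<le> K" using le_K[of st] \<open>0 \<le> K\<close> by (simp add: w)
      then have "w st - W st \<le> K * 1 + C * (1 + real (snd st))" using C(2)[OF that] by linarith
      also have "\<dots> \<le> K * (1 + real (snd st)) + C * (1 + real (snd st))"
        using \<open>0 \<le> K\<close> by (intro add_right_mono mult_left_mono) auto
      finally show ?thesis by (simp add: distrib_right)
    qed
    show "w st - W st \<le> 0" if "st \<in> race_states" "race_over A z st" for st
    proof -
      have "ennreal (w st) \<le> ennreal (f st)"
        unfolding w[symmetric] nn_integral_race_over[OF that(2), of "\<lambda>v. min v (ennreal K)"] by simp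
      then show ?thesis using one_step_solution_over[OF that] f by simp
    qed
    show "w st - W st
      \<le> p * (w (honest_block st) - W (honest_block st)) + q * (w (attacker_block st) - W (attacker_block st))"
      if "st \<in> race_states" "\<not> race_over A z st" for st
    proof -
      have "ennreal (w st) \<le> ennreal (c * tau0 + p * w (honest_block st) + q * w (attacker_block st))"
        using nn_integral_min_race_value_step[where f=f and K="ennreal K", OF that(2) c f]
        by (simp only: w ennreal_one_step[OF c w_nonneg w_nonneg])
      then have "w st \<le> c * tau0 + p * w (honest_block st) + q * w (attacker_block st)"
        using c p_pos q_pos tau0_pos w_nonneg by (subst (asm) ennreal_le_iff) auto
      then show ?thesis using one_step_solution_step[OF that] by (simp add: right_diff_distrib)
    qed
  qed (rule assms(1))
  then show ?thesis by (simp add: w ennreal_leI)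
qed

lemma nn_integral_race_value:
  assumes "st \<in> race_states"
  shows "(\<integral>\<^sup>+\<omega>. race_value c f st \<omega> \<partial>N) = ennreal (W st)"
proof (rule antisym)
  have upper: "(\<integral>\<^sup>+\<omega>. race_value c f st \<omega> \<partial>N) \<le> ennreal (W st)" if "st \<in> race_states" for st
  proof (rule nn_integral_le_min)
    show "(\<integral>\<^sup>+\<omega>. min (race_value c f st \<omega>) (of_nat n) \<partial>N) \<le> ennreal (W st)" for n
      using nn_integral_min_race_value_le[OF that, of "real n"]
      by (simp only: ennreal_of_nat_eq_real_of_nat of_nat_0_le_iff)
  qed measurable
  then show "(\<integral>\<^sup>+\<omega>. race_value c f st \<omega> \<partial>N) \<le> ennreal (W st)" using assms .
  define v where "v st = enn2real (\<integral>\<^sup>+\<omega>. race_value c f st \<omega> \<partial>N)" for st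
  have v: "(\<integral>\<^sup>+\<omega>. race_value c f st \<omega> \<partial>N) = ennreal (v st)" if "st \<in> race_states" for st
    unfolding v_def using upper[OF that] by (rule ennreal_enn2real_le)
  have v_nonneg: "0 \<le> v st" for st by (simp add: v_def)
  obtain C where C: "\<And>st. st \<in> race_states \<Longrightarrow> \<bar>W st\<bar> \<le> C * (1 + real (snd st))"
    using one_step_solution_growth by blast
  have "W st - v st \<le> 0"
  proof (rule one_step_max_principle[where C=C])
    show "W st - v st \<le> C * (1 + real (snd st))" if "st \<in> race_states" for st
      using C[OF that] v_nonneg[of st] by linarith
    show "W st - v st \<le> 0" if "st \<in> race_states" "race_over A z st" for st
      using nn_integral_race_over[OF that(2), of "\<lambda>v. v"] one_step_solution_over[OF that] f
      by (simp add: v_def)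
    show "W st - v st
      \<le> p * (W (honest_block st) - v (honest_block st)) + q * (W (attacker_block st) - v (attacker_block st))"
      if "st \<in> race_states" "\<not> race_over A z st" for st
    proof -
      have "ennreal (v st) = ennreal (c * tau0 + p * v (honest_block st) + q * v (attacker_block st))"
        using nn_integral_race_value_step[where f=f, OF that(2) c f] race_states_closed[OF that]
        by (simp only: v that ennreal_one_step[OF c v_nonneg v_nonneg])
      then have "v st = c * tau0 + p * v (honest_block st) + q * v (attacker_block st)"
        using c p_pos q_pos tau0_pos v_nonneg by (subst (asm) ennreal_inj) auto
      then show ?thesis using one_step_solution_step[OF that] by (simp add: right_diff_distrib)
    qed
  qed (rule assms)
  then show "ennreal (W st) \<le> (\<integral>\<^sup>+\<omega>. race_value c f st \<omega> \<partial>N)"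
    unfolding v[OF assms] by (simp add: ennreal_leI)
qed

end

end

lemma linear_growth_cofinite:
  fixes W :: "'s \<Rightarrow> real" and size :: "'s \<Rightarrow> nat"
  assumes "finite F" and bound: "\<And>st. st \<in> S - F \<Longrightarrow> \<bar>W st\<bar> \<le> C * (1 + real (size st))"
  shows "\<exists>C'. \<forall>st\<in>S. \<bar>W st\<bar> \<le> C' * (1 + real (size st))"
proof (intro exI ballI)
  fix st assume "st \<in> S"
  let ?C = "\<Sum>st\<in>F. \<bar>W st\<bar>"
  have C: "0 \<le> ?C" by (simp add: sum_nonneg)
  have "\<bar>W st\<bar> \<le> (if st \<in> F then ?C else \<bar>C\<bar>) * (1 + real (size st))"
  proof (cases "st \<in> F")
    case True
    then have "\<bar>W st\<bar> \<le> ?C * 1" using assms(1) by (auto intro: member_le_sum)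
    also have "\<dots> \<le> ?C * (1 + real (size st))" using C by (intro mult_left_mono) auto
    finally show ?thesis using True by simp
  next
    case False
    have "C * (1 + real (size st)) \<le> \<bar>C\<bar> * (1 + real (size st))" by (intro mult_right_mono) auto
    with False bound[of st] \<open>st \<in> S\<close> show ?thesis by (auto intro: order_trans)
  qed
  also have "\<dots> \<le> (\<bar>C\<bar> + ?C) * (1 + real (size st))"
    using C by (intro mult_right_mono) auto
  finally show "\<bar>W st\<bar> \<le> (\<bar>C\<bar> + ?C) * (1 + real (size st))" .
qed

context mining
begin

lemma p_eq: "p = 1 - q" and q_eq: "1 - p = q"
  using p_plus_q by simp_all

text \<open>Since \<open>z \<le> A\<close>, the race cannot end before the \<open>z\<close>-th official block. Up to then the value is a
  solution \<open>L\<close> of the unrestricted one-step equation, corrected by the negative binomial average of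
  the defect \<open>g - L\<close> at the \<open>z\<close>-th official block.\<close>

definition backward_extension :: "(nat \<Rightarrow> nat \<Rightarrow> real) \<Rightarrow> (nat \<Rightarrow> nat \<Rightarrow> real) \<Rightarrow> nat \<Rightarrow> nat \<Rightarrow> real" where
  "backward_extension g L h s =
    (if z \<le> h then g h s
     else L h s + nbin_average p z (\<lambda>t. if t \<le> z then g z t - L z t else 0) (z - h) s)"

context
  fixes c Cg CL :: real and f :: "race_state \<Rightarrow> real" and g L :: "nat \<Rightarrow> nat \<Rightarrow> real"
  assumes over: "\<And>h s. race_over A z (h, s) \<Longrightarrow> g h s = f (h, s)"
    and g_step: "\<And>h s. s \<le> h \<Longrightarrow> g h s = c * tau0 + p * g (Suc h) s + q * g h (Suc s)"
    and g_growth: "\<And>h s. h \<le> s + A \<Longrightarrow> \<bar>g h s\<bar> \<le> Cg * (1 + real s)"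
    and L_step: "\<And>h s. L h s = c * tau0 + p * L (Suc h) s + q * L h (Suc s)"
    and L_growth: "\<And>h s. h \<le> z \<Longrightarrow> \<bar>L h s\<bar> \<le> CL * (1 + real s)"
    and g_eq_L: "\<And>s. z < s \<Longrightarrow> g z s = L z s"
begin

lemma backward_extension_early:
  "h \<le> z \<Longrightarrow> backward_extension g L h s
    = L h s + nbin_average p z (\<lambda>t. if t \<le> z then g z t - L z t else 0) (z - h) s"
  using g_eq_L[of s] by (cases "h = z") (auto simp: backward_extension_def nbin_average_0)

lemma backward_extension_start:
  "backward_extension g L 0 1 = L 0 1 + (\<Sum>k<z. nbin_weight z p k * (g z (Suc k) - L z (Suc k)))"
  unfolding backward_extension_early[OF le0] nbin_average_def lessThan_Suc_atMost[symmetric] by simp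

lemma backward_extension_step:
  assumes "h < s + A" "\<not> race_over A z (h, s)"
  shows "backward_extension g L h s
    = c * tau0 + p * backward_extension g L (Suc h) s + q * backward_extension g L h (Suc s)"
proof (cases "z \<le> h")
  case True
  then show ?thesis using g_step[of s h] assms by (auto simp: backward_extension_def race_over_def)
next
  case False
  define \<phi> where "\<phi> t = (if t \<le> z then g z t - L z t else 0)" for t
  have "z - h = Suc (z - Suc h)" using False by simp
  then have "nbin_average p z \<phi> (z - h) s
      = p * nbin_average p z \<phi> (z - Suc h) s + q * nbin_average p z \<phi> (z - h) (Suc s)"
    using nbin_average_Suc[of z \<phi> p "z - Suc h" s] by (simp add: q_eq \<phi>_def)
  then show ?thesis
    using False L_step[of h s] by (simp add: backward_extension_early distrib_left flip: \<phi>_def)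
qed

lemma backward_extension_growth:
  assumes "(h, s) \<in> race_states - {..<z} \<times> {..z}"
  shows "\<bar>backward_extension g L h s\<bar> \<le> (\<bar>Cg\<bar> + \<bar>CL\<bar>) * (1 + real s)"
proof -
  have mono: "C * (1 + real s) \<le> (\<bar>Cg\<bar> + \<bar>CL\<bar>) * (1 + real s)" if "C = Cg \<or> C = CL" for C
    using that by (intro mult_right_mono) auto
  show ?thesis
  proof (cases "z \<le> h")
    case True
    then have "\<bar>backward_extension g L h s\<bar> \<le> Cg * (1 + real s)"
      using g_growth[of h s] assms by (simp add: backward_extension_def race_states_def)
    with mono[of Cg] show ?thesis by linarith
  next
    case False
    then have "z < s" "h < z" using assms by auto
    then have "\<bar>backward_extension g L h s\<bar> \<le> CL * (1 + real s)"
      using L_growth[of h s] by (simp add: backward_extension_def nbin_average_eq_0)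
    with mono[of CL] show ?thesis by linarith
  qed
qed

lemma one_step_solution_backward_extension:
  obtains W where "one_step_solution c f W"
    "W (0, 0) = c * tau0 / q + (L 0 1 + (\<Sum>k<z. nbin_weight z p k * (g z (Suc k) - L z (Suc k))))"
proof -
  define w where "w = c * tau0 / q + backward_extension g L 0 1"
  let ?W = "\<lambda>(h, s). if s = 0 then w else backward_extension g L h s"
  have "?W st = (if race_over A z st then f st
      else c * tau0 + p * ?W (honest_block st) + q * ?W (attacker_block st))"
    if st: "st \<in> race_states" for st
  proof -
    obtain h s where hs: "st = (h, s)" by fastforce
    consider "s = 0" "h = 0" | "0 < s" "race_over A z st" | "0 < s" "\<not> race_over A z st"
      using st by (auto simp: hs race_states_def)
    then show ?thesis
    proof cases
      case 1
      have "w = c * tau0 + p * w + q * backward_extension g L 0 1"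
        unfolding w_def p_eq using q_pos by (simp add: field_simps)
      with 1 show ?thesis
        using z_pos z_le_A by (simp add: hs race_over_def honest_block_def attacker_block_def)
    next
      case 2
      then have "z \<le> h" using z_le_A by (auto simp: hs race_over_def)
      with 2 show ?thesis using over by (simp add: hs backward_extension_def)
    next
      case 3
      then have "h < s + A" using st by (auto simp: hs race_states_def race_over_def)
      with 3 show ?thesis
        using backward_extension_step by (simp add: hs honest_block_def attacker_block_def)
    qed
  qed
  moreover have "\<exists>C. \<forall>st\<in>race_states. \<bar>?W st\<bar> \<le> C * (1 + real (snd st))"
  proof (rule linear_growth_cofinite[where F="{..<z} \<times> {..z}" and C="\<bar>Cg\<bar> + \<bar>CL\<bar>"])
    fix st assume st: "st \<in> race_states - {..<z} \<times> {..z}"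
    obtain h s where hs: "st = (h, s)" by fastforce
    have "0 < s" using st z_pos by (cases s) (auto simp: hs race_states_def)
    then show "\<bar>?W st\<bar> \<le> (\<bar>Cg\<bar> + \<bar>CL\<bar>) * (1 + real (snd st))"
      using backward_extension_growth[of h s] st by (simp add: hs)
  qed simp
  ultimately have "one_step_solution c f ?W" by (simp add: one_step_solution_def)
  then show ?thesis by (rule that) (unfold prod.case w_def backward_extension_start, simp)
qed

end

text \<open>After the \<open>z\<close>-th official block the lag is a gambler's ruin walk stopped at \<open>-1\<close> and \<open>A\<close>. For lag
  \<open>n - 1\<close>, \<open>ruin n\<close> is the probability of reaching \<open>A\<close>, \<open>ruin_time n\<close> the expected remaining time and
  \<open>mined n\<close> the expected number of further attacker blocks on the event of success.\<close>

definition odds :: real where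
  "odds = q / p"

definition ruin_norm :: real where
  "ruin_norm = 1 - odds ^ (A + 1)"

definition ruin :: "nat \<Rightarrow> real" where
  "ruin n = (1 - odds ^ n) / ruin_norm"

definition ruin_time :: "nat \<Rightarrow> real" where
  "ruin_time n = tau0 * (real (A + 1) * ruin n - real n) / (p - q)"

definition mined :: "nat \<Rightarrow> real" where
  "mined n = (p * (real n * odds ^ n) + q * odds ^ (A + 1) * real n) / ((p - q) * ruin_norm)
     - real (A + 1) * odds ^ (A + 1) / ((p - q) * ruin_norm\<^sup>2) * (1 - odds ^ n)"

lemma p_times_odds: "p * odds = q"
  using p_pos by (simp add: odds_def)

lemma p_times_one_minus_odds: "p * (1 - odds) = p - q"
  by (simp add: p_times_odds right_diff_distrib)

lemma ruin_norm_pos: "0 < ruin_norm"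
  using power_Suc_less_one[of odds A] q_pos q_less_p by (simp add: ruin_norm_def odds_def)

lemma p_times_odds_power: "p * odds ^ Suc n = q * odds ^ n"
  by (simp add: p_times_odds flip: mult.assoc)

lemma odds_power_step: "odds ^ Suc n = p * odds ^ Suc (Suc n) + q * odds ^ n"
proof -
  have "odds ^ Suc n = q * odds ^ Suc n + p * odds ^ Suc n"
    by (simp only: distrib_right[symmetric] add.commute[of q] p_plus_q mult_1)
  then show ?thesis by (simp only: p_times_odds_power)
qed

lemma nat_times_odds_power_step:
  "real (Suc n) * odds ^ Suc n
    = p * (real (Suc (Suc n)) * odds ^ Suc (Suc n)) + q * (real n * odds ^ n) + q * (1 - odds) * odds ^ n"
proof -
  have "(1 + m) * y = p * ((1 + (1 + m)) * w) + q * (m * x) + (q * x - q * y)"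
    if "y = p * w + q * x" "p * w = q * y" for m x y w
    using that by algebra
  from this[OF odds_power_step p_times_odds_power, of "real n" n] show ?thesis
    by (simp add: algebra_simps)
qed

lemma ruin_0: "ruin 0 = 0" and ruin_top: "ruin (Suc A) = 1"
  using ruin_norm_pos by (auto simp: ruin_def ruin_norm_def)

lemma ruin_step: "ruin (Suc n) = p * ruin (Suc (Suc n)) + q * ruin n"
proof -
  have "1 - odds ^ Suc n = p * (1 - odds ^ Suc (Suc n)) + q * (1 - odds ^ n)"
    unfolding right_diff_distrib using odds_power_step[of n] p_plus_q by linarith
  then show ?thesis by (simp only: ruin_def add_divide_distrib times_divide_eq_right)
qed

lemma ruin_time_0: "ruin_time 0 = 0" and ruin_time_top: "ruin_time (Suc A) = 0"
  by (simp_all add: ruin_time_def ruin_0 ruin_top)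

lemma ruin_time_step: "ruin_time (Suc n) = tau0 + p * ruin_time (Suc (Suc n)) + q * ruin_time n"
proof -
  define r where "r = 1 / (p - q)"
  have r: "(p - q) * r = 1" using q_less_p by (simp add: r_def)
  have time: "ruin_time m = tau0 * (real (A + 1) * ruin m - real m) * r" for m
    by (simp add: ruin_time_def r_def)
  show ?thesis
    unfolding time ruin_step[of n] of_nat_Suc using p_plus_q r by algebra
qed

lemma mined_0: "mined 0 = 0" and mined_top: "mined (Suc A) = 0"
proof -
  show "mined 0 = 0" by (simp add: mined_def)
  have "mined (Suc A) = (p + q) * (real (A + 1) * odds ^ (A + 1)) / ((p - q) * ruin_norm)
      - real (A + 1) * odds ^ (A + 1) / ((p - q) * ruin_norm\<^sup>2) * ruin_norm"
    by (simp add: mined_def ruin_norm_def distrib_right mult_ac)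
  then show "mined (Suc A) = 0"
    using ruin_norm_pos by (simp add: p_plus_q power2_eq_square)
qed

lemma mined_step: "mined (Suc n) = p * mined (Suc (Suc n)) + q * (mined n + (1 - ruin n))"
proof -
  define L where "L = odds ^ (A + 1)"
  define a where "a = 1 / ((p - q) * ruin_norm)"
  define k where "k = real (A + 1) * L / ((p - q) * ruin_norm\<^sup>2)"
  have mined: "mined m = (p * (real m * odds ^ m) + q * L * real m) * a - k * (1 - odds ^ m)" for m
    by (simp add: mined_def a_def k_def L_def)
  have "1 - ruin n = (ruin_norm - (1 - odds ^ n)) / ruin_norm"
    using ruin_norm_pos by (simp add: ruin_def diff_divide_distrib)
  also have "\<dots> = (p - q) * a * (odds ^ n - L)"
    using q_less_p by (simp add: a_def ruin_norm_def L_def)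
  finally have success: "1 - ruin n = (p - q) * a * (odds ^ n - L)" .
  define x y w where "x = odds ^ n" and "y = odds ^ Suc n" and "w = odds ^ Suc (Suc n)"
  have "y = p * w + q * x"
    and "(1 + real n) * y = p * ((1 + (1 + real n)) * w) + q * (real n * x) + q * (1 - odds) * x"
    using odds_power_step[of n] nat_times_odds_power_step[of n]
    by (simp_all only: x_def y_def w_def of_nat_Suc)
  then have "mined (Suc n) - p * mined (Suc (Suc n)) - q * mined n
      = a * q * (p * (1 - odds)) * x + a * q * L * (q - p)"
    unfolding mined of_nat_Suc x_def[symmetric] y_def[symmetric] w_def[symmetric] using p_plus_q by algebra
  also have "\<dots> = q * (1 - ruin n)"
    unfolding p_times_one_minus_odds success x_def by (simp add: algebra_simps)
  finally show ?thesis by (simp add: algebra_simps)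
qed

definition gained_blocks :: "race_state \<Rightarrow> real" where
  "gained_blocks st = (case st of (h, s) \<Rightarrow> if h < s then real s - 1 else 0)"

text \<open>\<open>c\<close> is the reward per unit of time and \<open>e\<close> the reward per gained block: the duration is the case
  \<open>c = 1\<close>, \<open>e = 0\<close>, the block reward the case \<open>c = 0\<close>, \<open>e = 1\<close>.\<close>

definition late_value :: "real \<Rightarrow> real \<Rightarrow> nat \<Rightarrow> nat \<Rightarrow> real" where
  "late_value c e h s = c * ruin_time (Suc h - s)
     + e * ((real s - 1) * (1 - ruin (Suc h - s)) + mined (Suc h - s))"

definition early_value :: "real \<Rightarrow> real \<Rightarrow> nat \<Rightarrow> nat \<Rightarrow> real" where
  "early_value c e h s = e * (real s - 1) + (real z - real h) * ((c * tau0 + q * e) / p)"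

lemma late_value_over: "race_over A z (h, s) \<Longrightarrow> late_value c e h s = e * gained_blocks (h, s)"
  by (auto simp: late_value_def gained_blocks_def race_over_def Suc_diff_le
      ruin_0 ruin_top ruin_time_0 ruin_time_top mined_0 mined_top)

lemma late_value_step:
  assumes "s \<le> h"
  shows "late_value c e h s = c * tau0 + p * late_value c e (Suc h) s + q * late_value c e h (Suc s)"
proof -
  define n where "n = h - s"
  have n: "Suc h - s = Suc n" "Suc (Suc h) - s = Suc (Suc n)" "Suc h - Suc s = n"
    using assms by (auto simp: n_def)
  have "1 - ruin (Suc n) = p * (1 - ruin (Suc (Suc n))) + q * (1 - ruin n)"
    using ruin_step[of n] p_plus_q by algebra
  then show ?thesis
    unfolding late_value_def n ruin_time_step[of n] mined_step[of n] of_nat_Suc by algebra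
qed

lemma late_value_growth:
  assumes "h \<le> s + A"
  shows "\<bar>late_value c e h s\<bar>
    \<le> (\<Sum>n\<le>Suc A. \<bar>c * ruin_time n\<bar> + \<bar>e * (1 - ruin n)\<bar> + \<bar>e * mined n\<bar>) * (1 + real s)"
proof -
  define n where "n = Suc h - s"
  define C where "C n = \<bar>c * ruin_time n\<bar> + \<bar>e * (1 - ruin n)\<bar> + \<bar>e * mined n\<bar>" for n
  have "late_value c e h s = c * ruin_time n + (real s - 1) * (e * (1 - ruin n)) + e * mined n"
    by (simp add: late_value_def n_def algebra_simps)
  also have "\<bar>\<dots>\<bar> \<le> 1 * \<bar>c * ruin_time n\<bar> + \<bar>real s - 1\<bar> * \<bar>e * (1 - ruin n)\<bar> + 1 * \<bar>e * mined n\<bar>"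
    unfolding abs_mult[symmetric, of "real s - 1"] mult_1 by linarith
  also have "\<dots> \<le> (1 + real s) * \<bar>c * ruin_time n\<bar> + (1 + real s) * \<bar>e * (1 - ruin n)\<bar>
      + (1 + real s) * \<bar>e * mined n\<bar>"
    by (intro add_mono mult_right_mono) auto
  also have "\<dots> = C n * (1 + real s)" by (simp add: C_def algebra_simps)
  also have "C n \<le> (\<Sum>n\<le>Suc A. C n)"
    using assms by (intro member_le_sum) (auto simp: n_def C_def)
  finally show ?thesis by (simp add: C_def mult_right_mono)
qed

lemma early_value_step:
  "early_value c e h s = c * tau0 + p * early_value c e (Suc h) s + q * early_value c e h (Suc s)"
proof -
  define r where "r = (c * tau0 + q * e) / p"
  define m where "m = real z - real h"
  have r: "p * r = c * tau0 + q * e" using p_pos by (simp add: r_def)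
  have "real z - real (Suc h) = m - 1" by (simp add: m_def)
  then have "c * tau0 + p * early_value c e (Suc h) s + q * early_value c e h (Suc s)
      = (p + q) * (e * (real s - 1) + m * r) + (c * tau0 + q * e - p * r)"
    unfolding early_value_def r_def[symmetric] m_def[symmetric] by (simp add: algebra_simps)
  also have "\<dots> = early_value c e h s"
    unfolding early_value_def r_def[symmetric] m_def[symmetric] by (simp add: r p_plus_q)
  finally show ?thesis ..
qed

lemma early_value_growth:
  assumes "0 \<le> c" "0 \<le> e" "h \<le> z"
  shows "\<bar>early_value c e h s\<bar> \<le> (e + real z * ((c * tau0 + q * e) / p)) * (1 + real s)"
proof -
  define r where "r = (c * tau0 + q * e) / p"
  have r: "0 \<le> r" using assms q_pos p_pos tau0_pos by (simp add: r_def)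
  have "\<bar>early_value c e h s\<bar> \<le> \<bar>e * (real s - 1)\<bar> + \<bar>(real z - real h) * r\<bar>"
    unfolding early_value_def r_def[symmetric] by (rule abs_triangle_ineq)
  also have "\<dots> \<le> e * (1 + real s) + real z * r"
    using assms r unfolding abs_mult by (intro add_mono mult_mono) auto
  also have "\<dots> \<le> e * (1 + real s) + real z * r * (1 + real s)"
    using r by (simp add: distrib_left[of "real z * r"])
  finally show ?thesis by (simp add: r_def distrib_right)
qed

lemma one_step_solution_race:
  assumes "0 \<le> c" "0 \<le> e"
  obtains W where "one_step_solution c (\<lambda>st. e * gained_blocks st) W"
    "W (0, 0) = c * tau0 / q + (real z * ((c * tau0 + q * e) / p)
      + (\<Sum>k<z. nbin_weight z p k * (c * ruin_time (z - k) + e * (mined (z - k) - real k * ruin (z - k)))))"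
proof -
  let ?g = "late_value c e" and ?L = "early_value c e"
  have join: "?g z s = ?L z s" if "z < s" for s
    using that by (simp add: late_value_def early_value_def ruin_0 ruin_time_0 mined_0)
  from one_step_solution_backward_extension[where f="\<lambda>st. e * gained_blocks st" and c=c and g="?g" and L="?L",
      OF late_value_over late_value_step late_value_growth early_value_step early_value_growth[OF assms] join]
  obtain W where W: "one_step_solution c (\<lambda>st. e * gained_blocks st) W"
    "W (0, 0) = c * tau0 / q + (?L 0 1 + (\<Sum>k<z. nbin_weight z p k * (?g z (Suc k) - ?L z (Suc k))))"
    by blast
  moreover have "?g z (Suc k) - ?L z (Suc k) =
    c * ruin_time (z - k) + e * (mined (z - k) - real k * ruin (z - k))" for k
    by (simp add: late_value_def early_value_def algebra_simps)
  moreover have "?L 0 1 = real z * ((c * tau0 + q * e) / p)" by (simp add: early_value_def)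
  ultimately show ?thesis by (intro that[of W]) simp_all
qed

section \<open>Closed forms\<close>

abbreviation "beta_term \<equiv> p ^ z * q ^ z / Beta (real z) (real z)"

lemma inc_beta_four_p_q: "inc_beta (4 * p * q) (real z) (1/2) = 2 * nbin_cdf z z q"
proof -
  have "4 * q * (1 - q) = 4 * p * q" by (simp add: p_eq)
  then show ?thesis
    using inc_beta_quadratic[of "real z" q, unfolded \<open>4 * q * (1 - q) = 4 * p * q\<close>]
      nbin_cdf_eq_inc_beta[of q z z] q_pos q_less_p p_plus_q z_pos
    by simp
qed

lemma inc_beta_p_minus_q: "inc_beta ((p - q)\<^sup>2) (1/2) (real z) = 1 - inc_beta (4 * p * q) (real z) (1/2)"
proof -
  have "1 - (p - q)\<^sup>2 = 4 * p * q" using p_plus_q by algebra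
  moreover have "(p - q)\<^sup>2 \<le> 1" using q_pos q_less_p p_plus_q by (simp add: power_le_one)
  ultimately show ?thesis
    using inc_beta_reflect[of "1/2" "real z" "(p - q)\<^sup>2"] z_pos by simp
qed

lemma nbin_cdf_p: "nbin_cdf z z p = 1 - nbin_cdf z z q"
  using nbin_cdf_add_eq_1[of q z z] q_pos q_less_p p_plus_q z_pos by (simp add: p_eq)

lemma nbin_weight_times_odds_power: "k < z \<Longrightarrow> nbin_weight z p k * odds ^ (z - k) = nbin_weight z q k"
  using nbin_weight_odds[of p k z] p_pos by (simp add: q_eq odds_def)

lemma nbin_sum_ruin:
  "(\<Sum>k<z. nbin_weight z p k * (1 - odds ^ (z - k))) = nbin_cdf z z p - nbin_cdf z z q"
  unfolding nbin_cdf_def sum_subtractf[symmetric]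
  by (intro sum.cong) (auto simp: right_diff_distrib nbin_weight_times_odds_power)

lemma nbin_truncated_mean_diff:
  "r * (\<Sum>k<z. nbin_weight z r k * real (z - k))
    = real z * (2 * r - 1) * nbin_cdf z z r + r ^ z * (1 - r) ^ z / Beta (real z) (real z)"
proof -
  define S where "S = (\<Sum>k<z. nbin_weight z r k * real (z - k))"
  define \<mu> where "\<mu> = (\<Sum>k<z. real k * nbin_weight z r k)"
  have S: "S = real z * nbin_cdf z z r - \<mu>"
    unfolding S_def \<mu>_def nbin_cdf_def sum_distrib_left sum_subtractf[symmetric]
    by (intro sum.cong) (auto simp: algebra_simps of_nat_diff)
  have \<mu>: "r * \<mu> = real z * (1 - r) * nbin_cdf z z r - r ^ z * (1 - r) ^ z / Beta (real z) (real z)"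
    unfolding \<mu>_def nbin_truncated_mean nbin_weight_Beta[OF z_pos z_pos] ..
  show ?thesis
    unfolding S_def[symmetric] S right_diff_distrib[of r] \<mu> by (simp add: algebra_simps)
qed

lemma nbin_sum_lag:
  "(\<Sum>k<z. nbin_weight z p k * real (z - k)) = (real z * (p - q) * nbin_cdf z z p + beta_term) / p"
proof -
  have "2 * p - 1 = p - q" using p_plus_q by simp
  then show ?thesis
    using nbin_truncated_mean_diff[of p] p_pos unfolding q_eq by (simp only: eq_divide_eq mult.commute) simp
qed

lemma nbin_sum_lag_odds:
  "(\<Sum>k<z. nbin_weight z p k * (real (z - k) * odds ^ (z - k))) =
    (beta_term - real z * (p - q) * nbin_cdf z z q) / q"
proof -
  have "(\<Sum>k<z. nbin_weight z p k * (real (z - k) * odds ^ (z - k))) =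
      (\<Sum>k<z. nbin_weight z q k * real (z - k))"
    by (intro sum.cong refl) (simp add: nbin_weight_times_odds_power[symmetric])
  moreover have "q * (\<Sum>k<z. nbin_weight z q k * real (z - k)) =
    beta_term - real z * (p - q) * nbin_cdf z z q"
    using nbin_truncated_mean_diff[of q] by (simp add: p_eq algebra_simps)
  ultimately show ?thesis using q_pos by (simp add: field_simps)
qed

lemma nbin_sum_ruin_time:
  "(\<Sum>k<z. nbin_weight z p k * ruin_time (z - k)) = tau0 *
     (real (A + 1) / ((p - q) * ruin_norm) * inc_beta ((p - q)\<^sup>2) (1/2) (real z)
       - real z / p * nbin_cdf z z p - beta_term / (p * (p - q)))"
proof -
  have "(\<Sum>k<z. nbin_weight z p k * ruin_time (z - k)) = tau0 / (p - q) *
      (real (A + 1) / ruin_norm * (\<Sum>k<z. nbin_weight z p k * (1 - odds ^ (z - k)))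
        - (\<Sum>k<z. nbin_weight z p k * real (z - k)))"
    unfolding ruin_time_def ruin_def sum_distrib_left sum_subtractf[symmetric]
    by (intro sum.cong refl) (simp add: divide_inverse algebra_simps)
  moreover have "(\<Sum>k<z. nbin_weight z p k * (1 - odds ^ (z - k))) = inc_beta ((p - q)\<^sup>2) (1/2) (real z)"
    unfolding nbin_sum_ruin inc_beta_p_minus_q inc_beta_four_p_q nbin_cdf_p by simp
  moreover have "tau0 / (p - q) * (x / ruin_norm * y - (real z * (p - q) * F + B) / p)
      = tau0 * (x / ((p - q) * ruin_norm) * y - real z / p * F - B / (p * (p - q)))" for x y F B
  proof -
    have "(real z * (p - q) * F + B) / p = (p - q) * (real z / p * F + B / (p * (p - q)))"
      using q_less_p p_pos by (simp add: distrib_left add_divide_distrib)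
    then show ?thesis using q_less_p by (simp add: field_simps)
  qed
  ultimately show ?thesis unfolding nbin_sum_lag by (simp only:)
qed

lemma mined_minus_ruin_eq:
  assumes "k \<le> z"
  shows "mined (z - k) - real k * ruin (z - k) =
    q / ((p - q) * ruin_norm) * (real (z - k) * odds ^ (z - k))
    + p * (1 - odds * ruin_norm) / ((p - q) * ruin_norm) * real (z - k)
    - (real (A + 1) * odds ^ (A + 1) / ((p - q) * ruin_norm\<^sup>2) + real z / ruin_norm) * (1 - odds ^ (z - k))"
proof -
  define n where "n = z - k"
  define a where "a = 1 / ((p - q) * ruin_norm)"
  have k: "real k = real z - real n" using assms by (simp add: n_def of_nat_diff)
  have "1 / ruin_norm = (p - q) * a"
    using q_less_p by (simp add: a_def)
  then have ruin: "ruin n = (p - q) * a * (1 - odds ^ n)" "real z / ruin_norm = real z * ((p - q) * a)"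
    unfolding ruin_def by (metis divide_inverse_commute inverse_eq_divide mult.commute)+
  have a: "x / ((p - q) * ruin_norm) = x * a" for x by (simp add: a_def)
  have "p * (1 - odds * ruin_norm) = p - (p * odds) * ruin_norm" by (simp add: right_diff_distrib mult.assoc)
  then have "p * (1 - odds * ruin_norm) = p - q + q * odds ^ (A + 1)"
    unfolding p_times_odds by (simp add: ruin_norm_def right_diff_distrib)
  moreover define x L P B where "x = odds ^ n" and "L = odds ^ (A + 1)" and "P = p * (1 - odds * ruin_norm)"
    and "B = real (A + 1) * odds ^ (A + 1) / ((p - q) * ruin_norm\<^sup>2)"
  ultimately show ?thesis
    unfolding n_def[symmetric] k mined_def ruin a x_def[symmetric] B_def[symmetric]
      P_def[symmetric] L_def[symmetric]
    by algebra
qed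

lemma nbin_sum_mined:
  "(\<Sum>k<z. nbin_weight z p k * (mined (z - k) - real k * ruin (z - k)))
    = (2 - odds * ruin_norm) * beta_term / ((p - q) * ruin_norm) - real z * odds * nbin_cdf z z p
      - real (A + 1) * odds ^ (A + 1) / ((p - q) * ruin_norm\<^sup>2) * inc_beta ((p - q)\<^sup>2) (1/2) (real z)"
  (is "?S = _")
proof -
  let ?B = "real (A + 1) * odds ^ (A + 1) / ((p - q) * ruin_norm\<^sup>2)"
  have "?S = (\<Sum>k<z. q / ((p - q) * ruin_norm) * (nbin_weight z p k * (real (z - k) * odds ^ (z - k)))
      + p * (1 - odds * ruin_norm) / ((p - q) * ruin_norm) * (nbin_weight z p k * real (z - k))
      - (?B + real z / ruin_norm) * (nbin_weight z p k * (1 - odds ^ (z - k))))"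
    by (intro sum.cong refl) (simp add: mined_minus_ruin_eq distrib_left right_diff_distrib mult_ac)
  also have "\<dots> = q / ((p - q) * ruin_norm) * ((beta_term - real z * (p - q) * nbin_cdf z z q) / q)
      + p * (1 - odds * ruin_norm) / ((p - q) * ruin_norm) * ((real z * (p - q) * nbin_cdf z z p + beta_term) / p)
      - (?B + real z / ruin_norm) * (nbin_cdf z z p - nbin_cdf z z q)"
    by (simp only: sum.distrib sum_subtractf sum_distrib_left[symmetric]
      nbin_sum_ruin nbin_sum_lag nbin_sum_lag_odds)
  also have "\<dots> = (beta_term - real z * (p - q) * nbin_cdf z z q) / ((p - q) * ruin_norm)
      + (1 - odds * ruin_norm) * (real z * (p - q) * nbin_cdf z z p + beta_term) / ((p - q) * ruin_norm)
      - (?B + real z / ruin_norm) * (nbin_cdf z z p - nbin_cdf z z q)"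
    using p_pos q_pos by simp
  also have "\<dots> = (2 - odds * ruin_norm) * beta_term / ((p - q) * ruin_norm) - real z * odds * nbin_cdf z z p
      - ?B * (nbin_cdf z z p - nbin_cdf z z q)"
  proof -
    have "(b - m * d * F) / (d * r) + (1 - odds * r) * (m * d * G + b) / (d * r) - (B + m / r) * (G - F)
        = (2 - odds * r) * b / (d * r) - m * odds * G - B * (G - F)"
      if "d \<noteq> 0" "r \<noteq> 0" for b m d F G B r :: real
      using that by (simp add: field_simps)
    then show ?thesis using q_less_p ruin_norm_pos by simp
  qed
  finally show ?thesis
    unfolding inc_beta_p_minus_q inc_beta_four_p_q nbin_cdf_p by simp
qed

end

section \<open>Expected revenue and duration of an attack cycle\<close>

lemma Nh_eq_counting: "Nh \<omega> = counting (hon_time \<omega>)" and Na_eq_counting: "Na \<omega> = counting (att_time \<omega>)"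
  by (simp_all add: fun_eq_iff Nh_def Na_def counting_def)

lemma hon_time_zip_seq: "hon_time (zip_seq (x, y)) = arrival x"
  and att_time_zip_seq: "att_time (zip_seq (x, y)) = arrival y"
  and premine_end_zip_seq: "premine_end (zip_seq (x, y)) = y 0"
  by (simp_all add: fun_eq_iff hon_time_def att_time_def premine_end_def arrival_def zip_seq_def)

definition success_blocks :: "nat \<Rightarrow> nat \<Rightarrow> (nat \<Rightarrow> real \<times> real) \<Rightarrow> real" where
  "success_blocks A z \<omega> = (if attack_success A z \<omega> then real_of_int (sec_len \<omega> (end_time A z \<omega>)) - 1 else 0)"

lemma race_path_eq_lengths:
  assumes "proper_waits x" "proper_waits y" "y 0 \<le> t"
  defines "\<omega> \<equiv> zip_seq (x, y)"
  shows "race_path (0, 0) (x, y) t = (nat (off_len \<omega> t), nat (sec_len \<omega> t))"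
    "0 \<le> off_len \<omega> t" "1 \<le> sec_len \<omega> t"
  using counting_mono[OF assms(1,3)] counting_mono[OF assms(2,3)] counting_first[OF assms(2)]
  by (auto simp: \<omega>_def race_path_def off_len_def sec_len_def Nh_eq_counting Na_eq_counting
      hon_time_zip_seq att_time_zip_seq premine_end_zip_seq nat_diff_distrib)

lemma race_path_premining:
  assumes "proper_waits x" "proper_waits y" "t < y 0"
  shows "race_path (0, 0) (x, y) t = (0, 0)"
  using counting_mono[OF assms(1) less_imp_le[OF assms(3)]] counting_before_first[OF assms(2,3)]
  by (simp add: race_path_def)

context mining
begin

abbreviation "M \<equiv> mining_space q tau0"

lemma attack_ended_zip_seq:
  assumes "proper_waits x" "proper_waits y"
  shows "attack_ended A z (zip_seq (x, y)) t \<longleftrightarrow> 0 \<le> t \<and> race_over A z (race_path (0, 0) (x, y) t)"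
proof (cases "y 0 \<le> t")
  case True
  moreover have "0 < y 0" using assms(2) by (simp add: proper_waits_def)
  ultimately show ?thesis
    using race_path_eq_lengths[OF assms True]
    by (auto simp: attack_ended_def race_over_def premine_end_zip_seq)
next
  case False
  then show ?thesis
    using race_path_premining[OF assms, of t] z_pos z_le_A
    by (simp add: attack_ended_def race_over_def premine_end_zip_seq)
qed

lemma end_time_zip_seq:
  assumes "proper_waits x" "proper_waits y"
  shows "end_time A z (zip_seq (x, y)) = stop_time (race_over A z) (race_path (0, 0) (x, y))"
  by (simp add: end_time_def stop_time_def attack_ended_zip_seq[OF assms])

lemma premine_le_end_time:
  assumes "attack_ended A z \<omega> t"
  shows "premine_end \<omega> \<le> end_time A z \<omega>"
  unfolding end_time_def using assms by (intro cInf_greatest) (auto simp: attack_ended_def)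

lemma duration_zip_seq:
  assumes "proper_waits x" "proper_waits y"
  shows "duration A z (zip_seq (x, y)) = enn2real (race_value 1 (\<lambda>_. 0) (0, 0) (x, y))"
  using stop_time_nonneg[of _ "race_over A z" "race_path (0, 0) (x, y)"]
  by (auto simp: duration_def race_value_def stopped_reward_def end_time_zip_seq[OF assms]
      attack_ended_zip_seq[OF assms])

lemma success_blocks_zip_seq:
  assumes "proper_waits x" "proper_waits y"
  shows "success_blocks A z (zip_seq (x, y)) = enn2real (race_value 0 gained_blocks (0, 0) (x, y))"
proof (cases "\<exists>t. attack_ended A z (zip_seq (x, y)) t")
  case True
  define T where "T = end_time A z (zip_seq (x, y))"
  have "y 0 \<le> T"
    using True premine_le_end_time[of "zip_seq (x, y)"] unfolding T_def premine_end_zip_seq by blast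
  note lengths = race_path_eq_lengths[OF assms this]
  have "race_value 0 gained_blocks (0, 0) (x, y) = ennreal (gained_blocks (race_path (0, 0) (x, y) T))"
    using True by (auto simp: race_value_def stopped_reward_def T_def end_time_zip_seq[OF assms]
        attack_ended_zip_seq[OF assms])
  with True lengths show ?thesis
    by (auto simp: success_blocks_def attack_success_def gained_blocks_def simp flip: T_def)
next
  case False
  then show ?thesis
    by (auto simp: success_blocks_def attack_success_def race_value_def stopped_reward_def
        attack_ended_zip_seq[OF assms])
qed

lemma mining_space_eq: "M = (\<Pi>\<^sub>M i\<in>UNIV. exp_measure (p / tau0) \<Otimes>\<^sub>M exp_measure (q / tau0))"
  by (simp add: mining_space_def p_eq)

lemma measurable_zip_seq_mining_space[measurable]: "zip_seq \<in> N \<rightarrow>\<^sub>M M"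
  unfolding mining_space_eq by measurable

lemma distr_zip_seq_mining_space: "distr N M zip_seq = M"
  unfolding mining_space_eq using a_pos b_pos by (intro distr_zip_seq prob_space_exponential_density)

sublocale M: prob_space M
  by (subst distr_zip_seq_mining_space[symmetric]) (rule prob_space_distr, measurable)

lemma measurable_mining_space_component[measurable]:
  shows "(\<lambda>\<omega>. fst (\<omega> i)) \<in> borel_measurable M" "(\<lambda>\<omega>. snd (\<omega> i)) \<in> borel_measurable M"
proof -
  have "(\<lambda>\<omega>. \<omega> i) \<in> M \<rightarrow>\<^sub>M exp_measure (p / tau0) \<Otimes>\<^sub>M exp_measure (q / tau0)"
    unfolding mining_space_eq by (rule measurable_component_singleton) simp
  from measurable_compose[OF this measurable_fst] measurable_compose[OF this measurable_snd]
  show "(\<lambda>\<omega>. fst (\<omega> i)) \<in> borel_measurable M" "(\<lambda>\<omega>. snd (\<omega> i)) \<in> borel_measurable M" by simp_all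
qed

lemma measurable_hon_time[measurable]: "(\<lambda>\<omega>. hon_time \<omega> k) \<in> borel_measurable M"
  and measurable_att_time[measurable]: "(\<lambda>\<omega>. att_time \<omega> k) \<in> borel_measurable M"
  and measurable_premine_end[measurable]: "premine_end \<in> borel_measurable M"
  unfolding hon_time_def att_time_def premine_end_def by measurable

lemma measurable_off_len[measurable (raw)]:
  assumes [measurable]: "T \<in> borel_measurable M"
  shows "(\<lambda>\<omega>. off_len \<omega> (T \<omega>)) \<in> M \<rightarrow>\<^sub>M count_space UNIV"
  unfolding off_len_def Nh_eq_counting
  by (rule measurable_compose_nat2[where f="\<lambda>_ i j. int i - int j"]) measurable

lemma measurable_sec_len[measurable (raw)]:
  assumes [measurable]: "T \<in> borel_measurable M"
  shows "(\<lambda>\<omega>. sec_len \<omega> (T \<omega>)) \<in> M \<rightarrow>\<^sub>M count_space UNIV"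
  unfolding sec_len_def Na_eq_counting
  by (rule measurable_compose_nat2[where f="\<lambda>_ i j. 1 + int i - int j"]) measurable

lemma measurable_Ex_attack_ended[measurable]: "Measurable.pred M (\<lambda>\<omega>. \<exists>t. attack_ended A z \<omega> t)"
  and measurable_end_time[measurable]: "end_time A z \<in> borel_measurable M"
proof -
  define Q where "Q \<omega> n m \<longleftrightarrow> (
      let off = int n - int (Nh \<omega> (premine_end \<omega>));
        sec = 1 + int m - int (Na \<omega> (premine_end \<omega>))
      in off - sec = int A \<or> int z \<le> off \<and> off < sec)" for \<omega> n m
  have Q: "Measurable.pred M (\<lambda>\<omega>. Q \<omega> n m)" for n m
    unfolding Q_def Nh_eq_counting Na_eq_counting
    by (rule measurable_compose_nat2[where f="\<lambda>_ i j. let off = int n - int i; sec = 1 + int m - int j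
        in off - sec = int A \<or> int z \<le> off \<and> off < sec"]) measurable
  have ended: "attack_ended A z \<omega> t \<longleftrightarrow>
      premine_end \<omega> \<le> t \<and> Q \<omega> (counting (hon_time \<omega>) t) (counting (att_time \<omega>) t)" for \<omega> t
    by (simp add: attack_ended_def Q_def off_len_def sec_len_def Nh_eq_counting Na_eq_counting Let_def)
  show "Measurable.pred M (\<lambda>\<omega>. \<exists>t. attack_ended A z \<omega> t)"
    unfolding ended by (rule pred_Ex_counting) (use Q in measurable)
  show "end_time A z \<in> borel_measurable M"
    unfolding end_time_def ended by (rule borel_measurable_Inf_counting) (use Q in measurable)
qed

lemma measurable_attack_success[measurable]: "Measurable.pred M (attack_success A z)"
  unfolding attack_success_def by measurable

lemma measurable_success_blocks[measurable]: "success_blocks A z \<in> borel_measurable M"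
  unfolding success_blocks_def by measurable

lemma measurable_duration[measurable]: "duration A z \<in> borel_measurable M"
  unfolding duration_def by measurable

lemma has_bochner_integral_mining_space:
  fixes F :: "(nat \<Rightarrow> real \<times> real) \<Rightarrow> real"
  assumes [measurable]: "F \<in> borel_measurable M"
    and F: "\<And>x y. proper_waits x \<Longrightarrow> proper_waits y \<Longrightarrow>
        F (zip_seq (x, y)) = enn2real (race_value c f (0, 0) (x, y))"
    and W: "one_step_solution c f W" and c: "0 \<le> c" and f: "\<And>st. 0 \<le> f st"
  shows "has_bochner_integral M F (W (0, 0))"
proof -
  have start: "(0, 0) \<in> race_states" by (simp add: race_states_def)
  note nn_integral_start = nn_integral_race_value[OF c f W start]
  have F_eq_race_value: "AE \<omega> in N. F (zip_seq \<omega>) = enn2real (race_value c f (0, 0) \<omega>)"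
    using AE_proper_waits by eventually_elim (use F in force)
  have "AE \<omega> in N. race_value c f (0, 0) \<omega> \<noteq> \<infinity>"
    using nn_integral_start by (intro nn_integral_noteq_infinite) simp_all
  with F_eq_race_value have "AE \<omega> in N. ennreal (F (zip_seq \<omega>)) = race_value c f (0, 0) \<omega>"
    by eventually_elim (simp add: ennreal_enn2real_if)
  then have "(\<integral>\<^sup>+\<omega>. ennreal (F (zip_seq \<omega>)) \<partial>N) = ennreal (W (0, 0))"
    unfolding nn_integral_start[symmetric] by (rule nn_integral_cong_AE)
  moreover have "AE \<omega> in N. 0 \<le> F (zip_seq \<omega>)"
    using F_eq_race_value by eventually_elim simp
  ultimately have "has_bochner_integral N (\<lambda>\<omega>. F (zip_seq \<omega>)) (W (0, 0))"
    using one_step_solution_nonneg[OF c f W start] by (intro has_bochner_integral_nn_integral) simp_all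
  then have "has_bochner_integral (distr N M zip_seq) F (W (0, 0))"
    by (simp add: has_bochner_integral_iff integrable_distr_eq integral_distr)
  then show ?thesis by (simp add: distr_zip_seq_mining_space)
qed

lemma closed_form_constants:
  shows "p * (1 - odds)\<^sup>2 * qint odds (A + 1) = (p - q) * ruin_norm"
    and "p * (1 - odds) ^ 3 * (qint odds (A + 1))\<^sup>2 = (p - q) * ruin_norm\<^sup>2"
    and "(1 - odds)\<^sup>2 * qint odds (A + 1) = (p - q) * ruin_norm / p"
    and "p ^ (z - 1) * q ^ z / Beta (real z) (real z) = beta_term / p"
    and "2 - odds + odds ^ (A + 2) = 2 - odds * ruin_norm"
proof -
  have "1 - odds = (p - q) / p" using p_pos p_times_one_minus_odds by (simp add: field_simps)
  then have "1 - odds \<noteq> 0" using q_less_p p_pos by simp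
  then have qint: "(1 - odds) * qint odds (A + 1) = ruin_norm" by (simp add: qint_def ruin_norm_def)
  have "p * (1 - odds)\<^sup>2 * qint odds (A + 1) = (p * (1 - odds)) * ((1 - odds) * qint odds (A + 1))"
    by (simp only: power2_eq_square mult_ac)
  then show "p * (1 - odds)\<^sup>2 * qint odds (A + 1) = (p - q) * ruin_norm"
    unfolding qint p_times_one_minus_odds .
  then show "(1 - odds)\<^sup>2 * qint odds (A + 1) = (p - q) * ruin_norm / p"
    using p_pos by (simp add: field_simps)
  have "p * (1 - odds) ^ 3 * (qint odds (A + 1))\<^sup>2 = (p * (1 - odds)) * ((1 - odds) * qint odds (A + 1))\<^sup>2"
    by (simp only: power2_eq_square power3_eq_cube mult_ac)
  then show "p * (1 - odds) ^ 3 * (qint odds (A + 1))\<^sup>2 = (p - q) * ruin_norm\<^sup>2"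
    unfolding qint p_times_one_minus_odds .
  have "p ^ z = p * p ^ (z - 1)" using z_pos by (cases z) auto
  then show "p ^ (z - 1) * q ^ z / Beta (real z) (real z) = beta_term / p" using p_pos by simp
  show "2 - odds + odds ^ (A + 2) = 2 - odds * ruin_norm" by (simp add: ruin_norm_def algebra_simps)
qed

lemma expected_duration:
  "(\<integral>\<omega>. duration A z \<omega> \<partial>M) / tau0 =
     real z / (2 * p) * inc_beta (4 * p * q) (real z) (1/2)
     + real (A + 1) / (p * (1 - odds)\<^sup>2 * qint odds (A + 1)) * inc_beta ((p - q)\<^sup>2) (1/2) (real z)
     - p ^ (z - 1) * q ^ z / (p * (1 - odds) * Beta (real z) (real z))
     + 1 / q"
proof -
  let ?J = "real (A + 1) / ((p - q) * ruin_norm) * inc_beta ((p - q)\<^sup>2) (1/2) (real z)"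
  obtain W where W: "one_step_solution 1 (\<lambda>_. 0) W"
    "W (0, 0) = tau0 / q + (real z * (tau0 / p) + (\<Sum>k<z. nbin_weight z p k * ruin_time (z - k)))"
    using one_step_solution_race[of 1 0] by auto
  have "has_bochner_integral M (duration A z) (W (0, 0))"
    by (rule has_bochner_integral_mining_space[OF _ duration_zip_seq W(1)]) simp_all
  then have "(\<integral>\<omega>. duration A z \<omega> \<partial>M) = tau0 / q + (real z * (tau0 / p) +
      tau0 * (?J - real z / p * nbin_cdf z z p - beta_term / (p * (p - q))))"
    unfolding has_bochner_integral_iff W(2) nbin_sum_ruin_time by simp
  moreover have "tau0 / q + (m * (tau0 / p) + tau0 * (J - m / p * F - B))
      = tau0 * (1 / q + m / p * (1 - F) + J - B)" for m J F B
    by (simp add: algebra_simps diff_divide_distrib)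
  ultimately have "(\<integral>\<omega>. duration A z \<omega> \<partial>M) / tau0
      = 1 / q + real z / p * (1 - nbin_cdf z z p) + ?J - beta_term / (p * (p - q))"
    using tau0_pos by simp
  also have "real z / p * (1 - nbin_cdf z z p) = real z / (2 * p) * inc_beta (4 * p * q) (real z) (1/2)"
    by (simp add: nbin_cdf_p inc_beta_four_p_q)
  also have "beta_term / (p * (p - q)) = p ^ (z - 1) * q ^ z / (p * (1 - odds) * Beta (real z) (real z))"
  proof -
    have "p ^ (z - 1) * q ^ z / (p * (1 - odds) * Beta (real z) (real z))
        = (p ^ (z - 1) * q ^ z / Beta (real z) (real z)) / (p - q)"
      unfolding p_times_one_minus_odds by (simp add: mult.commute)
    then show ?thesis unfolding closed_form_constants(4) by simp
  qed
  finally show ?thesis unfolding closed_form_constants by simp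
qed

lemma expected_success_blocks:
  "has_bochner_integral M (success_blocks A z)
     (q * real z / (2 * p) * inc_beta (4 * p * q) (real z) (1/2)
     - real (A + 1) * odds ^ (A + 1) / (p * (1 - odds) ^ 3 * (qint odds (A + 1))\<^sup>2)
          * inc_beta ((p - q)\<^sup>2) (1/2) (real z)
     + (2 - odds + odds ^ (A + 2)) / ((1 - odds)\<^sup>2 * qint odds (A + 1))
          * (p ^ (z - 1) * q ^ z / Beta (real z) (real z)))"
proof -
  obtain W where W: "one_step_solution 0 gained_blocks W"
    "W (0, 0) = real z * odds + (\<Sum>k<z. nbin_weight z p k * (mined (z - k) - real k * ruin (z - k)))"
    using one_step_solution_race[of 0 1] by (auto simp: odds_def)
  have "has_bochner_integral M (success_blocks A z) (W (0, 0))"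
    by (rule has_bochner_integral_mining_space[OF _ success_blocks_zip_seq W(1)])
      (auto simp: gained_blocks_def)
  moreover have "q * real z / (2 * p) * inc_beta (4 * p * q) (real z) (1/2) =
    real z * odds - real z * odds * nbin_cdf z z p"
    unfolding nbin_cdf_p inc_beta_four_p_q odds_def by (simp add: algebra_simps diff_divide_distrib)
  moreover have "(2 - odds * ruin_norm) / ((p - q) * ruin_norm / p) * (beta_term / p)
      = (2 - odds * ruin_norm) * beta_term / ((p - q) * ruin_norm)"
    using p_pos by simp
  ultimately show ?thesis
    unfolding W(2) nbin_sum_mined closed_form_constants
    by (simp only: add_diff_eq diff_add_eq diff_right_commute)
qed

lemma expected_revenue:
  assumes "0 < b"
  shows "(\<integral>\<omega>. revenue v b A z \<omega> \<partial>M) / b = (\<integral>\<omega>. success_blocks A z \<omega> \<partial>M)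
    + measure M {\<omega> \<in> space M. attack_success A z \<omega>} * (v / b + 1)"
proof -
  let ?S = "{\<omega> \<in> space M. attack_success A z \<omega>}"
  have S: "integrable M (indicator ?S :: _ \<Rightarrow> real)"
    by (intro integrable_real_indicator) (auto simp: less_top[symmetric])
  have "(\<integral>\<omega>. revenue v b A z \<omega> \<partial>M) = (\<integral>\<omega>. b * success_blocks A z \<omega> + (v + b) * indicator ?S \<omega> \<partial>M)"
    by (intro Bochner_Integration.integral_cong) (auto simp: revenue_def success_blocks_def algebra_simps)
  also have "\<dots> = b * (\<integral>\<omega>. success_blocks A z \<omega> \<partial>M) + (v + b) * measure M ?S"
    using expected_success_blocks S
    by (subst Bochner_Integration.integral_add) (auto simp: has_bochner_integral_iff)
  finally show ?thesis using assms by (simp add: field_simps)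
qed

end

theorem theorem2:
  fixes q tau0 b v :: real and z A :: nat
  assumes "0 < q" "q < 1/2" "0 < tau0" "0 < b" "0 \<le> v" "1 \<le> z" "z \<le> A"
  defines "(p::real) \<equiv> 1 - q"
  defines "(l::real) \<equiv> q / p"
  defines "M \<equiv> mining_space q tau0"
  defines "PA \<equiv> measure M {\<omega> \<in> space M. attack_success A z \<omega>}"
  shows "((\<integral>\<omega>. revenue v b A z \<omega> \<partial>M) / b =
           q * real z / (2 * p) * inc_beta (4 * p * q) (real z) (1/2)
         - real (A + 1) * l ^ (A + 1) / (p * (1 - l) ^ 3 * (qint l (A + 1))\<^sup>2)
             * inc_beta ((p - q)\<^sup>2) (1/2) (real z)
         + (2 - l + l ^ (A + 2)) / ((1 - l)\<^sup>2 * qint l (A + 1))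
             * (p ^ (z - 1) * q ^ z / Beta (real z) (real z))
         + PA * (v / b + 1)) \<and>
         ((\<integral>\<omega>. duration A z \<omega> \<partial>M) / tau0 =
           real z / (2 * p) * inc_beta (4 * p * q) (real z) (1/2)
         + real (A + 1) / (p * (1 - l)\<^sup>2 * qint l (A + 1)) * inc_beta ((p - q)\<^sup>2) (1/2) (real z)
         - p ^ (z - 1) * q ^ z / (p * (1 - l) * Beta (real z) (real z))
         + 1 / q)"
proof -
  interpret mining q p tau0 A z
    by unfold_locales (use assms in \<open>auto simp: p_def\<close>)
  have odds: "odds = l" by (simp add: odds_def assms(9))
  have "(\<integral>\<omega>. success_blocks A z \<omega> \<partial>M) =
      q * real z / (2 * p) * inc_beta (4 * p * q) (real z) (1/2)
      - real (A + 1) * l ^ (A + 1) / (p * (1 - l) ^ 3 * (qint l (A + 1))\<^sup>2)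
          * inc_beta ((p - q)\<^sup>2) (1/2) (real z)
      + (2 - l + l ^ (A + 2)) / ((1 - l)\<^sup>2 * qint l (A + 1))
          * (p ^ (z - 1) * q ^ z / Beta (real z) (real z))"
    unfolding M_def odds[symmetric] using expected_success_blocks by (rule has_bochner_integral_integral_eq)
  with expected_revenue[OF assms(4), of v] expected_duration show ?thesis
    unfolding M_def PA_def odds by simp
qed

end
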